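(* Let $(E,e,T)$ be a $T$-universally complete conditional Riesz triple. (a) For each $f\in L^\infty(T)$, the map $L^1(T)\to R(T)$, $g\mapsto T(fg)$, is $R(T)$-linear and $\|\cdot\|_{T,1}$-bounded. (b) The map $$\Phi\colon L^\infty(T)\to\widehat{L^1(T)},\qquad f\mapsto\bigl(g\mapsto T(fg)\bigr),$$ is an $R(T)$-linear isometric Riesz isomorphism.
   Context: All Riesz spaces are real. A conditional Riesz triple is a triple $(E,e,T)$ where $E$ is a Dedekind complete Riesz space, $e\in E_+$ is a weak order unit (the band generated by $e$ is $E$), and $T\colon E\to E$ is an order continuous, strictly positive ($f>0$ implies $Tf>0$) linear projection with $T(e)=e$ whose range $R(T)$ is a Dedekind complete Riesz subspace of $E$. Let $E^u$ denote the universal completion of $E$, in which $E$ is regarded as an order dense Riesz subspace; $E^u$ is an $f$-algebra with algebraic unit $e$, and products are taken in $E^u$. The triple is $T$-universally complete if every non-empty upwards directed $A\subseteq E$ such that $T[A]$ is bounded from above in $E^u$ has a supremum in $E$. In this case one writes $L^1(T):=E$; the range $R(T)$ is universally complete and is an $f$-algebra with algebraic unit and weak order unit $e$ under the multiplication of $E^u$; $E$ is an $R(T)$-module and $T(gf)=gT(f)$ for $g\in R(T)$, $f\in E$. $L^\infty(T):=\{f\in L^1(T): \exists g\in R(T)_+,\ |f|\le g\}$, an order ideal of $L^1(T)$ and an $R(T)$-module; $L^1(T)$ is an $L^\infty(T)$-module. The $R(T)$-valued norms are $\|f\|_{T,1}:=T(|f|)$ on $L^1(T)$ and $\|f\|_{T,\infty}:=\inf\{\alpha\in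 R(T)_+: |f|\le\alpha\}$ on $L^\infty(T)$. A map $\varphi$ from an $R(T)$-module to an $R(T)$-module is $R(T)$-linear if it is additive and $\varphi(gf)=g\varphi(f)$ for all $g\in R(T)$. An $R(T)$-linear map $\varphi\colon L^1(T)\to R(T)$ is $\|\cdot\|_{T,1}$-bounded if there is $g\in R(T)_+$ with $|\varphi(f)|\le g\|f\|_{T,1}$ for all $f\in L^1(T)$. A linear operator is regular if it is a difference of two positive linear operators. The $T$-strong dual $\widehat{L^1(T)}$ is the set of all $R(T)$-linear, regular, $\|\cdot\|_{T,1}$-bounded maps $\varphi\colon L^1(T)\to R(T)$. It is an order ideal and an $R(T)$-submodule of the Dedekind complete Riesz space $\mathrm L^{\mathrm r}(L^1(T),R(T))$ of regular operators (ordered by $\varphi\le\psi$ iff $\psi-\varphi$ is positive; pointwise operations), and is endowed with the $R(T)$-valued norm $$\|\varphi\|_{\widehat{L^1(T)}}:=\inf\{g\in R(T)_+:\ |\varphi(f)|\le g\|f\|_{T,1}\ \text{for all } f\in L^1(T)\}.$$ Isometric means $\|\Phi(f)\|_{\widehat{L^1(T)}}=\|f\|_{T,\infty}$ for all $f\in L^\infty(T)$. *)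

theory Defs
  imports Complex_Main "HOL-Library.Lub_Glb" "HOL-Library.Lattice_Algebras" "HOL-Library.FuncSet"
begin

section \<open>Riesz spaces and f-algebras\<close>

class riesz_space = ordered_real_vector + lattice_ab_group_add_abs

class f_algebra = riesz_space + real_algebra + lattice_ring +
  assumes f_left: "inf a b = 0 \<Longrightarrow> 0 \<le> c \<Longrightarrow> inf (c * a) b = 0"
    and f_right: "inf a b = 0 \<Longrightarrow> 0 \<le> c \<Longrightarrow> inf (a * c) b = 0"

text \<open>
  Riesz spaces occurring below are Riesz subspaces \<open>F\<close> of an ambient Riesz space. Suprema and infima
  are always relative to the space at hand: \<open>isLub F A s\<close> says that \<open>s\<close> is the supremum of \<open>A\<close>
  formed in \<open>F\<close>.
\<close>

definition riesz_subspace :: "'a::riesz_space set \<Rightarrow> bool" where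
  "riesz_subspace F \<longleftrightarrow> subspace F \<and> (\<forall>x\<in>F. \<forall>y\<in>F. sup x y \<in> F \<and> inf x y \<in> F)"

definition dedekind_complete :: "'a::riesz_space set \<Rightarrow> bool" where
  "dedekind_complete F \<longleftrightarrow>
     (\<forall>A. A \<subseteq> F \<and> A \<noteq> {} \<and> (\<exists>u. isUb F A u) \<longrightarrow> (\<exists>s. isLub F A s))"

definition laterally_complete :: "'a::riesz_space set \<Rightarrow> bool" where
  "laterally_complete F \<longleftrightarrow>
     (\<forall>A. A \<subseteq> F \<and> A \<noteq> {} \<and> (\<forall>x\<in>A. 0 \<le> x) \<and> (\<forall>x\<in>A. \<forall>y\<in>A. x \<noteq> y \<longrightarrow> inf x y = 0)
        \<longrightarrow> (\<exists>s. isLub F A s))"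

definition universally_complete :: "'a::riesz_space set \<Rightarrow> bool" where
  "universally_complete F \<longleftrightarrow> dedekind_complete F \<and> laterally_complete F"

definition order_dense :: "'a::riesz_space set \<Rightarrow> bool" where
  "order_dense F \<longleftrightarrow> (\<forall>x>0. \<exists>y\<in>F. 0 < y \<and> y \<le> x)"

text \<open>The universal completion of \<open>E\<close> is the whole type \<open>'a\<close>.\<close>

definition universal_completion_of :: "'a::riesz_space set \<Rightarrow> bool" where
  "universal_completion_of E \<longleftrightarrow>
     universally_complete (UNIV :: 'a set) \<and> riesz_subspace E \<and> order_dense E"

definition order_ideal :: "'a::riesz_space set \<Rightarrow> 'a set \<Rightarrow> bool" where
  "order_ideal E I \<longleftrightarrow> I \<subseteq> E \<and> subspace I \<and> (\<forall>x\<in>E. \<forall>y\<in>I. \<bar>x\<bar> \<le> \<bar>y\<bar> \<longrightarrow> x \<in> I)"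

definition band :: "'a::riesz_space set \<Rightarrow> 'a set \<Rightarrow> bool" where
  "band E B \<longleftrightarrow> order_ideal E B \<and> (\<forall>A s. A \<subseteq> B \<and> isLub E A s \<longrightarrow> s \<in> B)"

definition weak_order_unit :: "'a::riesz_space set \<Rightarrow> 'a \<Rightarrow> bool" where
  "weak_order_unit E e \<longleftrightarrow> e \<in> E \<and> 0 \<le> e \<and> band E hull {e} = E"

definition linear_op :: "'a::riesz_space set \<Rightarrow> 'a set \<Rightarrow> ('a \<Rightarrow> 'a) \<Rightarrow> bool" where
  "linear_op E F \<phi> \<longleftrightarrow> \<phi> \<in> E \<rightarrow> F \<and>
     (\<forall>x\<in>E. \<forall>y\<in>E. \<phi> (x + y) = \<phi> x + \<phi> y) \<and> (\<forall>a. \<forall>x\<in>E. \<phi> (a *\<^sub>R x) = a *\<^sub>R \<phi> x)"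

definition positive_op :: "'a::riesz_space set \<Rightarrow> ('a \<Rightarrow> 'a) \<Rightarrow> bool" where
  "positive_op E \<phi> \<longleftrightarrow> (\<forall>x\<in>E. 0 \<le> x \<longrightarrow> 0 \<le> \<phi> x)"

text \<open>
  Order continuity of a positive operator: \<open>x\<^sub>\<alpha> \<down> 0\<close> implies \<open>T x\<^sub>\<alpha> \<down> 0\<close>. The ranges of decreasing nets are
  exactly the nonempty downwards directed sets.
\<close>

definition order_continuous :: "'a::riesz_space set \<Rightarrow> ('a \<Rightarrow> 'a) \<Rightarrow> bool" where
  "order_continuous E T \<longleftrightarrow>
     (\<forall>D. D \<subseteq> E \<and> D \<noteq> {} \<and> (\<forall>x\<in>D. \<forall>y\<in>D. \<exists>z\<in>D. z \<le> x \<and> z \<le> y) \<and> isGlb E D 0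
        \<longrightarrow> isGlb E (T ` D) 0)"


section \<open>Conditional Riesz triples\<close>

text \<open>
  Only the values of \<open>T\<close> on \<open>E\<close> matter; the range \<open>R(T)\<close> is \<open>T ` E\<close>.
\<close>

definition conditional_riesz_triple :: "'a::riesz_space set \<Rightarrow> 'a \<Rightarrow> ('a \<Rightarrow> 'a) \<Rightarrow> bool" where
  "conditional_riesz_triple E e T \<longleftrightarrow>
     riesz_subspace E \<and> dedekind_complete E \<and> weak_order_unit E e \<and>
     linear_op E E T \<and> (\<forall>f\<in>E. T (T f) = T f) \<and>
     order_continuous E T \<and> (\<forall>f\<in>E. 0 < f \<longrightarrow> 0 < T f) \<and> T e = e \<and>
     riesz_subspace (T ` E) \<and> dedekind_complete (T ` E)"

definition T_universally_complete :: "'a::riesz_space set \<Rightarrow> ('a \<Rightarrow> 'a) \<Rightarrow> bool" where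
  "T_universally_complete E T \<longleftrightarrow>
     (\<forall>A. A \<subseteq> E \<and> A \<noteq> {} \<and> (\<forall>x\<in>A. \<forall>y\<in>A. \<exists>z\<in>A. x \<le> z \<and> y \<le> z) \<and> (\<exists>u. isUb UNIV (T ` A) u)
        \<longrightarrow> (\<exists>s. isLub E A s))"

definition L_infty :: "'a::riesz_space set \<Rightarrow> ('a \<Rightarrow> 'a) \<Rightarrow> 'a set" where
  "L_infty E T = {f \<in> E. \<exists>g\<in>T ` E. 0 \<le> g \<and> \<bar>f\<bar> \<le> g}"

definition norm_1 :: "('a::riesz_space \<Rightarrow> 'a) \<Rightarrow> 'a \<Rightarrow> 'a" where
  "norm_1 T f = T \<bar>f\<bar>"

definition glb_in :: "'a::riesz_space set \<Rightarrow> 'a set \<Rightarrow> 'a" where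
  "glb_in F A = (THE x. isGlb F A x)"

definition norm_infty :: "'a::riesz_space set \<Rightarrow> ('a \<Rightarrow> 'a) \<Rightarrow> 'a \<Rightarrow> 'a" where
  "norm_infty E T f = glb_in (T ` E) {\<alpha> \<in> T ` E. 0 \<le> \<alpha> \<and> \<bar>f\<bar> \<le> \<alpha>}"


section \<open>The T-strong dual\<close>

text \<open>
  \<open>R\<close>-linearity of a map defined on the \<open>R\<close>-module \<open>M\<close>, for a codomain with addition \<open>add\<close> and scalar
  multiplication \<open>smult\<close>.
\<close>

definition module_linear ::
  "'a::f_algebra set \<Rightarrow> 'a set \<Rightarrow> ('b \<Rightarrow> 'b \<Rightarrow> 'b) \<Rightarrow> ('a \<Rightarrow> 'b \<Rightarrow> 'b) \<Rightarrow> ('a \<Rightarrow> 'b) \<Rightarrow> bool" where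
  "module_linear R M add smult \<phi> \<longleftrightarrow>
     (\<forall>x\<in>M. \<forall>y\<in>M. \<phi> (x + y) = add (\<phi> x) (\<phi> y)) \<and>
     (\<forall>g\<in>R. \<forall>x\<in>M. \<phi> (g * x) = smult g (\<phi> x))"

definition norm_1_bounded :: "'a::f_algebra set \<Rightarrow> ('a \<Rightarrow> 'a) \<Rightarrow> ('a \<Rightarrow> 'a) \<Rightarrow> bool" where
  "norm_1_bounded E T \<phi> \<longleftrightarrow> (\<exists>g\<in>T ` E. 0 \<le> g \<and> (\<forall>f\<in>E. \<bar>\<phi> f\<bar> \<le> g * norm_1 T f))"

text \<open>
  Operators between \<open>E\<close> and \<open>R\<close> are represented by functions that are \<open>undefined\<close> outside \<open>E\<close>, so that
  equality of operators is equality of functions.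
\<close>

definition regular_ops :: "'a::riesz_space set \<Rightarrow> 'a set \<Rightarrow> ('a \<Rightarrow> 'a) set" where
  "regular_ops E R = {\<phi> \<in> E \<rightarrow>\<^sub>E R. \<exists>\<phi>1 \<phi>2.
     linear_op E R \<phi>1 \<and> positive_op E \<phi>1 \<and> linear_op E R \<phi>2 \<and> positive_op E \<phi>2 \<and>
     (\<forall>f\<in>E. \<phi> f = \<phi>1 f - \<phi>2 f)}"

definition op_le :: "'a::riesz_space set \<Rightarrow> ('a \<Rightarrow> 'a) \<Rightarrow> ('a \<Rightarrow> 'a) \<Rightarrow> bool" where
  "op_le E \<phi> \<psi> \<longleftrightarrow> positive_op E (\<lambda>f. \<psi> f - \<phi> f)"

definition op_add :: "'a::riesz_space set \<Rightarrow> ('a \<Rightarrow> 'a) \<Rightarrow> ('a \<Rightarrow> 'a) \<Rightarrow> 'a \<Rightarrow> 'a" where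
  "op_add E \<phi> \<psi> = (\<lambda>f\<in>E. \<phi> f + \<psi> f)"

definition op_scaleR :: "'a::riesz_space set \<Rightarrow> real \<Rightarrow> ('a \<Rightarrow> 'a) \<Rightarrow> 'a \<Rightarrow> 'a" where
  "op_scaleR E a \<phi> = (\<lambda>f\<in>E. a *\<^sub>R \<phi> f)"

definition op_mult :: "'a::f_algebra set \<Rightarrow> 'a \<Rightarrow> ('a \<Rightarrow> 'a) \<Rightarrow> 'a \<Rightarrow> 'a" where
  "op_mult E g \<phi> = (\<lambda>f\<in>E. g * \<phi> f)"

definition op_is_sup :: "'a::riesz_space set \<Rightarrow> 'a set \<Rightarrow> ('a \<Rightarrow> 'a) \<Rightarrow> ('a \<Rightarrow> 'a) \<Rightarrow> ('a \<Rightarrow> 'a) \<Rightarrow> bool" where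
  "op_is_sup E R \<phi> \<psi> \<sigma> \<longleftrightarrow> \<sigma> \<in> regular_ops E R \<and> op_le E \<phi> \<sigma> \<and> op_le E \<psi> \<sigma> \<and>
     (\<forall>\<tau>\<in>regular_ops E R. op_le E \<phi> \<tau> \<and> op_le E \<psi> \<tau> \<longrightarrow> op_le E \<sigma> \<tau>)"

definition op_is_inf :: "'a::riesz_space set \<Rightarrow> 'a set \<Rightarrow> ('a \<Rightarrow> 'a) \<Rightarrow> ('a \<Rightarrow> 'a) \<Rightarrow> ('a \<Rightarrow> 'a) \<Rightarrow> bool" where
  "op_is_inf E R \<phi> \<psi> \<sigma> \<longleftrightarrow> \<sigma> \<in> regular_ops E R \<and> op_le E \<sigma> \<phi> \<and> op_le E \<sigma> \<psi> \<and>
     (\<forall>\<tau>\<in>regular_ops E R. op_le E \<tau> \<phi> \<and> op_le E \<tau> \<psi> \<longrightarrow> op_le E \<tau> \<sigma>)"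

definition strong_dual :: "'a::f_algebra set \<Rightarrow> ('a \<Rightarrow> 'a) \<Rightarrow> ('a \<Rightarrow> 'a) set" where
  "strong_dual E T =
     {\<phi> \<in> regular_ops E (T ` E). module_linear (T ` E) E (+) (*) \<phi> \<and> norm_1_bounded E T \<phi>}"

definition dual_norm :: "'a::f_algebra set \<Rightarrow> ('a \<Rightarrow> 'a) \<Rightarrow> ('a \<Rightarrow> 'a) \<Rightarrow> 'a" where
  "dual_norm E T \<phi> =
     glb_in (T ` E) {g \<in> T ` E. 0 \<le> g \<and> (\<forall>f\<in>E. \<bar>\<phi> f\<bar> \<le> g * norm_1 T f)}"

text \<open>
  The strong dual is an order ideal, in particular a Riesz subspace, of the regular operators, so its
  lattice operations are the ones of the regular operators.
\<close>

definition riesz_isomorphism_to_dual ::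
  "'a::f_algebra set \<Rightarrow> ('a \<Rightarrow> 'a) \<Rightarrow> 'a set \<Rightarrow> ('a \<Rightarrow> 'a \<Rightarrow> 'a) \<Rightarrow> bool" where
  "riesz_isomorphism_to_dual E T L \<Phi> \<longleftrightarrow>
     bij_betw \<Phi> L (strong_dual E T) \<and>
     (\<forall>f\<in>L. \<forall>g\<in>L. \<Phi> (f + g) = op_add E (\<Phi> f) (\<Phi> g)) \<and>
     (\<forall>a. \<forall>f\<in>L. \<Phi> (a *\<^sub>R f) = op_scaleR E a (\<Phi> f)) \<and>
     (\<forall>f\<in>L. \<forall>g\<in>L. op_is_sup E (T ` E) (\<Phi> f) (\<Phi> g) (\<Phi> (sup f g)) \<and>
                     op_is_inf E (T ` E) (\<Phi> f) (\<Phi> g) (\<Phi> (inf f g)))"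

definition Phi :: "'a::f_algebra set \<Rightarrow> ('a \<Rightarrow> 'a) \<Rightarrow> 'a \<Rightarrow> 'a \<Rightarrow> 'a" where
  "Phi E T f = (\<lambda>g\<in>E. T (f * g))"

end

theory Submission
  imports Defs
begin

text \<open>
  For \<open>g\<close> in \<open>R(T)\<close>, the averaging identity \<open>T (g * f) = g * T f\<close> follows from the case of a component of
  \<open>e\<close> by Freudenthal approximation and then truncation. It makes the maps \<open>g \<mapsto> T (f * g)\<close>
  \<open>R(T)\<close>-linear, and testing with \<open>x = (f - g)\<^sup>+ \<sqinter> e\<close> shows that they determine the order of the
  multipliers; hence \<open>\<Phi>\<close> is injective and the sets defining the two norms of \<open>f\<close> coincide.

  Surjectivity is a Radon-Nikodym theorem. After adding a multiple of \<open>T\<close>, a functional in the strong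
  dual satisfies \<open>0 \<le> \<psi> \<le> G T\<close>; a maximal \<open>h\<close> with \<open>T (h * x) \<le> \<psi> x\<close> on \<open>[0, e]\<close> represents \<open>\<psi>\<close>, since
  otherwise a Hahn-type argument enlarges \<open>h\<close>.
\<close>

section \<open>Riesz spaces and unital f-algebras\<close>

text \<open>The obstacle throughout is that \<open>E\<close> need not be closed under products,
  while additivity and monotonicity of \<open>T\<close> are available only on \<open>E\<close>; each
  product has to be placed in \<open>E\<close> before \<open>T\<close> is applied to it. This rests
  on \<open>E\<close> being an order ideal of the ambient algebra, a consequence of Dedekind
  completeness and order density. The class \<open>f_algebra\<close> does not assume commutativity
  either; it is derived by the same approximation scheme.

  Truncation has one quantitative source: for \<open>0 \<le> x\<close>, cutting \<open>x\<close> at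
  \<open>k e\<close> costs at most \<open>x * x\<close> divided by \<open>k\<close>. This bound may
  lie outside \<open>E\<close>, yet by the Archimedean property it shows that the errors decrease to
  0 in \<open>E\<close>, where order continuity of \<open>T\<close> takes over.

  In the Radon-Nikodym part the values are vectors of \<open>R(T)\<close>, so the failure of
  \<open>0 \<le> \<sigma> p\<close> does not give \<open>\<sigma> p \<le> 0\<close>. Multiplication
  by elements of \<open>R(T)\<close> localises to the part where a value is negative; in this way
  \<open>R(T)\<close>-linearity replaces the scalar dichotomy of the classical Hahn
  argument.\<close>

lemma pprt_diff_pprt_minus: "pprt x - pprt (- x) = (x::'a::lattice_ab_group_add)"
  by (metis diff_minus_eq_add pprt_neg prts)

lemma abs_eq_pprt_add: "\<bar>x\<bar> = pprt x + pprt (- x :: 'a::lattice_ab_group_add_abs)"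
  by (simp add: abs_prts pprt_neg)

lemma inf_pprt_pprt_minus: "inf (pprt x) (pprt (- x)) = (0::'a::lattice_ab_group_add)"
proof -
  have "inf (pprt x) (pprt (- x)) = inf (pprt (- x) + x) (pprt (- x) + 0)"
    using pprt_diff_pprt_minus[of x] by (simp add: algebra_simps)
  also have "\<dots> = pprt (- x) + nprt x"
    by (simp only: add_inf_distrib_left[symmetric] nprt_def)
  finally show ?thesis
    by (simp add: pprt_neg)
qed

lemma pprt_ge_self: "x \<le> pprt (x::'a::lattice_ab_group_add)"
  by (simp add: pprt_def)

lemma inf_zero_mono:
  fixes a :: "'a::lattice_ab_group_add"
  assumes "inf a b = 0" "0 \<le> a'" "a' \<le> a" "0 \<le> b'" "b' \<le> b"
  shows "inf a' b' = 0"
  using assms inf_mono[of a' a b' b] by (simp add: order_antisym)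

lemma sup_eq_add_if_inf_zero:
  "inf a b = (0::'a::lattice_ab_group_add) \<Longrightarrow> sup a b = a + b"
  using add_eq_inf_sup[of a b] by simp

lemma sup_eq_add_pprt: "sup f g = g + pprt (f - g :: 'a::lattice_ab_group_add)"
  by (simp add: pprt_def add_sup_distrib_left)

lemma inf_eq_diff_pprt: "inf f g = f - pprt (f - g :: 'a::lattice_ab_group_add)"
  using add_eq_inf_sup[of f g] sup_eq_add_pprt[of f g] by (simp add: eq_diff_eq add.assoc) (metis add.commute)

lemma isLub_iff:
  "isLub F A s \<longleftrightarrow> s \<in> F \<and> (\<forall>a\<in>A. a \<le> s) \<and> (\<forall>u\<in>F. (\<forall>a\<in>A. a \<le> u) \<longrightarrow> s \<le> u)"
  by (auto simp: isLub_def leastP_def isUb_def setle_def setge_def)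

lemma isGlb_iff:
  "isGlb F A s \<longleftrightarrow> s \<in> F \<and> (\<forall>a\<in>A. s \<le> a) \<and> (\<forall>u\<in>F. (\<forall>a\<in>A. u \<le> a) \<longrightarrow> u \<le> s)"
  by (auto simp: isGlb_def greatestP_def isLb_def setle_def setge_def)

lemma dedekind_completeE:
  assumes "dedekind_complete F" "A \<subseteq> F" "A \<noteq> {}" "u \<in> F" "\<And>a. a \<in> A \<Longrightarrow> a \<le> u"
  obtains s where "isLub F A s"
proof -
  have "isUb F A u"
    using assms(4,5) by (simp add: isUb_def setle_def)
  then show thesis
    using assms(1-3) that unfolding dedekind_complete_def by blast
qed

text \<open>If \<open>s\<close> is the supremum of the multiples of \<open>w\<close>, then
  \<open>s - w\<close> is an upper bound too, because \<open>s\<close> dominates the multiple with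
  index \<open>Suc n\<close>. Hence \<open>s \<le> s - w\<close>.\<close>

lemma dedekind_complete_archimedean:
  fixes w b :: "'a::riesz_space"
  assumes "dedekind_complete (UNIV :: 'a set)" and le: "\<And>n::nat. real n *\<^sub>R w \<le> b"
  shows "w \<le> 0"
proof -
  obtain s where "isLub UNIV (range (\<lambda>n::nat. real n *\<^sub>R w)) s"
    using dedekind_completeE[OF assms(1), of "range (\<lambda>n::nat. real n *\<^sub>R w)" b] le by auto
  then have s: "real n *\<^sub>R w \<le> s" and least: "(\<And>n. real n *\<^sub>R w \<le> u) \<Longrightarrow> s \<le> u" for n u
    by (auto simp: isLub_iff)
  have "s \<le> s - w"
    using s[of "Suc n" for n] by (intro least) (simp add: algebra_simps)
  then show ?thesis
    by (simp add: le_diff_eq)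
qed

lemma scaleR_nonneg: "0 \<le> c \<Longrightarrow> 0 \<le> x \<Longrightarrow> 0 \<le> c *\<^sub>R (x::'a::ordered_real_vector)"
  using scaleR_left_mono[of 0 x c] by simp

text \<open>The f-algebra axioms make \<open>a * b\<close> disjoint from \<open>b\<close> and then,
  on multiplying \<open>b\<close> by \<open>a\<close>, disjoint from itself.\<close>

lemma mult_eq_zero_if_inf_zero:
  fixes a b :: "'a::f_algebra"
  assumes "inf a b = 0"
  shows "a * b = 0"
proof -
  have "0 \<le> a" "0 \<le> b"
    using assms by (metis inf.cobounded1, metis inf.cobounded2)
  have "inf (a * b) b = 0"
    using f_left[OF _ \<open>0 \<le> a\<close>, of b b] f_right[OF assms \<open>0 \<le> b\<close>] by simp
  then have "inf b (a * b) = 0"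
    by (simp add: inf_commute)
  then have "inf (a * b) (a * b) = 0"
    using f_left \<open>0 \<le> a\<close> by blast
  then show ?thesis
    by simp
qed

lemma riesz_subspaceD:
  assumes "riesz_subspace F"
  shows "0 \<in> F" "x \<in> F \<Longrightarrow> y \<in> F \<Longrightarrow> x + y \<in> F" "x \<in> F \<Longrightarrow> y \<in> F \<Longrightarrow> x - y \<in> F"
    "x \<in> F \<Longrightarrow> - x \<in> F" "x \<in> F \<Longrightarrow> c *\<^sub>R x \<in> F"
    "x \<in> F \<Longrightarrow> y \<in> F \<Longrightarrow> sup x y \<in> F" "x \<in> F \<Longrightarrow> y \<in> F \<Longrightarrow> inf x y \<in> F"
    "x \<in> F \<Longrightarrow> pprt x \<in> F" "x \<in> F \<Longrightarrow> \<bar>x\<bar> \<in> F"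
proof -
  have F: "subspace F" "\<And>x y. x \<in> F \<Longrightarrow> y \<in> F \<Longrightarrow> sup x y \<in> F \<and> inf x y \<in> F"
    using assms by (auto simp: riesz_subspace_def)
  note s = subspace_0[OF F(1)] subspace_add[OF F(1)] subspace_diff[OF F(1)] subspace_neg[OF F(1)]
    subspace_scale[OF F(1)]
  show "0 \<in> F" "x \<in> F \<Longrightarrow> y \<in> F \<Longrightarrow> x + y \<in> F" "x \<in> F \<Longrightarrow> y \<in> F \<Longrightarrow> x - y \<in> F"
    "x \<in> F \<Longrightarrow> - x \<in> F" "x \<in> F \<Longrightarrow> c *\<^sub>R x \<in> F"
    by (fact s)+
  show "x \<in> F \<Longrightarrow> y \<in> F \<Longrightarrow> sup x y \<in> F" "x \<in> F \<Longrightarrow> y \<in> F \<Longrightarrow> inf x y \<in> F"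
    by (simp_all add: F(2))
  show "x \<in> F \<Longrightarrow> pprt x \<in> F" "x \<in> F \<Longrightarrow> \<bar>x\<bar> \<in> F"
    by (simp_all add: F(2) s(1,4) pprt_def abs_lattice)
qed

text \<open>Zorn's lemma in the form used for minorants and for the Hahn-type argument: only
  nonempty chains have to be bounded, and there the bound is a supremum formed in
  \<open>E\<close>.\<close>

lemma exists_maximal:
  fixes A :: "'a::order set"
  assumes "A \<noteq> {}"
    and "\<And>C. C \<subseteq> A \<Longrightarrow> C \<noteq> {} \<Longrightarrow> (\<And>x y. x \<in> C \<Longrightarrow> y \<in> C \<Longrightarrow> x \<le> y \<or> y \<le> x) \<Longrightarrow> \<exists>u\<in>A. \<forall>a\<in>C. a \<le> u"
  shows "\<exists>m\<in>A. \<forall>a\<in>A. m \<le> a \<longrightarrow> a = m"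
proof (rule predicate_Zorn)
  show "partial_order_on A (relation_of (\<le>) A)"
    by (rule partial_order_on_relation_ofI) auto
  fix C assume "C \<in> Chains (relation_of (\<le>) A)"
  then have "C \<subseteq> A" "\<And>x y. x \<in> C \<Longrightarrow> y \<in> C \<Longrightarrow> x \<le> y \<or> y \<le> x"
    by (auto simp: Chains_def relation_of_def)
  then show "\<exists>u\<in>A. \<forall>a\<in>C. a \<le> u"
    using assms(1) assms(2)[of C] by (cases "C = {}") blast+
qed

locale unital_f_algebra =
  fixes e :: "'a::f_algebra"
  assumes e_mult [simp]: "e * x = x" and mult_e [simp]: "x * e = x"
    and e_nonneg [simp]: "0 \<le> e"
    and dedekind_complete_UNIV: "dedekind_complete (UNIV :: 'a set)"
begin

section \<open>Archimedean estimates and truncation at multiples of the unit\<close>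

lemma archimedean:
  assumes "\<And>n::nat. real n *\<^sub>R w \<le> (b::'a)"
  shows "w \<le> 0"
  using dedekind_complete_archimedean[OF dedekind_complete_UNIV assms] .

lemma archimedean_inverse:
  assumes "\<And>n::nat. w \<le> (1 / real (Suc n)) *\<^sub>R (b::'a)"
  shows "w \<le> 0"
proof (rule archimedean)
  fix n :: nat
  \<comment> \<open>The absolute value covers \<open>n = 0\<close>, where the bound has to be
    nonnegative.\<close>
  show "real n *\<^sub>R w \<le> \<bar>b\<bar>"
  proof (cases n)
    case (Suc m)
    then have "real n *\<^sub>R w \<le> real n *\<^sub>R ((1 / real (Suc m)) *\<^sub>R b)"
      by (intro scaleR_left_mono assms) auto
    also have "\<dots> = b"
      using Suc by simp
    finally show ?thesis
      using abs_ge_self order_trans by blast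
  qed simp
qed

lemma archimedean_pos:
  assumes "\<And>\<delta>. 0 < \<delta> \<Longrightarrow> w \<le> \<delta> *\<^sub>R (b::'a)"
  shows "w \<le> 0"
  by (rule archimedean_inverse[of _ b], rule assms) simp

text \<open>Disjointness from \<open>e\<close> survives multiplication of \<open>e\<close> by
  \<open>x\<close>, so \<open>x\<close> is disjoint from itself: the algebraic unit is a weak order
  unit of the ambient space.\<close>

lemma inf_e_eq_zero:
  assumes "inf x e = 0"
  shows "x = 0"
proof -
  have "0 \<le> x"
    using assms by (metis inf.cobounded1)
  have "inf e x = 0"
    using assms by (simp add: inf_commute)
  from f_left[OF this \<open>0 \<le> x\<close>] show ?thesis
    by simp
qed

text \<open>A Chebyshev-type estimate. The positive part \<open>y\<close> of \<open>x - t e\<close>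
  annihilates the negative part, so \<open>y * x = t y + y * y\<close>, and
  \<open>y \<le> x\<close>. Both the truncation error and the vanishing of elements with square 0
  come from it.\<close>

lemma scaleR_pprt_le_square:
  assumes "0 \<le> x" "0 \<le> t"
  shows "t *\<^sub>R pprt (x - t *\<^sub>R e) \<le> x * x"
proof -
  define y z where "y = pprt (x - t *\<^sub>R e)" and "z = pprt (- (x - t *\<^sub>R e))"
  have "y * z = 0"
    using mult_eq_zero_if_inf_zero inf_pprt_pprt_minus unfolding y_def z_def by blast
  have [simp]: "0 \<le> y" "0 \<le> z"
    by (simp_all add: y_def z_def)
  have x: "x = t *\<^sub>R e + y - z"
    using pprt_diff_pprt_minus[of "x - t *\<^sub>R e"] unfolding y_def z_def by (simp add: algebra_simps)
  have "x - t *\<^sub>R e \<le> x"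
    using assms by (simp add: scaleR_nonneg)
  then have "y \<le> x"
    using assms by (simp add: y_def pprt_def)
  have "t *\<^sub>R y \<le> t *\<^sub>R y + y * y"
    by (simp add: mult_nonneg_nonneg)
  also have "\<dots> = y * x"
    using \<open>y * z = 0\<close> by (subst x) (simp add: algebra_simps)
  also have "\<dots> \<le> x * x"
    using \<open>y \<le> x\<close> assms by (simp add: mult_right_mono)
  finally show ?thesis
    by (simp add: y_def)
qed

lemma truncation_error:
  assumes "0 \<le> x"
  shows "x - inf x (real (Suc k) *\<^sub>R e) \<le> (1 / real (Suc k)) *\<^sub>R (x * x)"
proof -
  have "x - inf x (real (Suc k) *\<^sub>R e) = pprt (x - real (Suc k) *\<^sub>R e)"
    by (simp only: inf_eq_diff_pprt) simp
  also have "\<dots> = (1 / real (Suc k)) *\<^sub>R (real (Suc k) *\<^sub>R pprt (x - real (Suc k) *\<^sub>R e))"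
    by simp
  also have "\<dots> \<le> (1 / real (Suc k)) *\<^sub>R (x * x)"
    using assms by (intro scaleR_left_mono scaleR_pprt_le_square) auto
  finally show ?thesis .
qed

lemma square_eq_zero:
  assumes "0 \<le> x" "x * x = (0::'a)"
  shows "x = 0"
proof (rule order_antisym)
  show "x \<le> 0"
  proof (rule archimedean_pos)
    fix t :: real assume "0 < t"
    then have "(1/t) *\<^sub>R (t *\<^sub>R pprt (x - t *\<^sub>R e)) \<le> (1/t) *\<^sub>R (x * x)"
      using assms by (intro scaleR_left_mono scaleR_pprt_le_square) auto
    then have "pprt (x - t *\<^sub>R e) \<le> 0"
      using assms \<open>0 < t\<close> by simp
    then show "x \<le> t *\<^sub>R e"
      using pprt_ge_self order_trans by (metis diff_le_0_iff_le)
  qed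
qed fact

text \<open>The square of \<open>inf x e\<close> lies below \<open>inf x e * x\<close>, hence
  vanishes. Test elements can therefore be cut down to \<open>[0, e]\<close> and still detect
  \<open>x = 0\<close>.\<close>

lemma inf_e_mult_eq_zero:
  assumes "0 \<le> x" "inf x e * x = 0"
  shows "x = 0"
proof -
  have "inf x e * inf x e \<le> inf x e * x"
    using assms by (intro mult_left_mono) auto
  then have "inf x e * inf x e = 0"
    using assms by (simp add: order_antisym mult_nonneg_nonneg)
  then show ?thesis
    using square_eq_zero[of "inf x e"] assms inf_e_eq_zero by simp
qed


subsection \<open>Components, Freudenthal approximation and commutativity\<close>

text \<open>\<open>p\<close> is the supremum of the elements \<open>e \<sqinter> n y\<close>, the
  analogue of the indicator of the set where \<open>y\<close> is positive. It is formed inside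
  \<open>F\<close> because the averaging identity needs components lying in \<open>R(T)\<close>;
  accordingly, disjointness is asserted for \<open>w\<close> in \<open>F\<close>.\<close>

lemma component_exists:
  assumes F: "riesz_subspace F" "dedekind_complete F" "e \<in> F"
    and "y \<in> F" "0 \<le> y"
  obtains p where "p \<in> F" "0 \<le> p" "p \<le> e" "inf p (e - p) = 0" "p * y = y"
    "\<And>w. w \<in> F \<Longrightarrow> inf y w = 0 \<Longrightarrow> inf p w = 0"
proof -
  note [intro, simp] = riesz_subspaceD[OF F(1)]
  define t where "t n = inf e (real n *\<^sub>R y)" for n
  have t: "t n \<in> F" "0 \<le> t n" "t n \<le> e" "t n \<le> real n *\<^sub>R y" for n
    using assms by (simp_all add: t_def scaleR_nonneg)
  obtain p where "isLub F (range t) p"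
    using dedekind_completeE[OF F(2), of "range t" e] t F(3) by blast
  then have p: "p \<in> F" "\<And>n. t n \<le> p" "\<And>u. u \<in> F \<Longrightarrow> (\<And>n. t n \<le> u) \<Longrightarrow> p \<le> u"
    by (auto simp: isLub_iff)
  have "0 \<le> p" "p \<le> e"
    using order_trans[OF t(2) p(2)] p(3)[OF F(3)] t(3) by auto
  have disj: "inf p w = 0" if "w \<in> F" "inf y w = 0" for w
  proof -
    have "0 \<le> w"
      using that by (metis inf.cobounded2)
    \<comment> \<open>\<open>t n\<close> and \<open>inf p w\<close> are disjoint and both below
      \<open>p\<close>, so their sum is their supremum and stays below \<open>p\<close>.\<close>
    have "t n \<le> p - inf p w" for n
    proof -
      have "inf (t n) w = 0"
      proof -
        have "inf (real n *\<^sub>R y) w = 0"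
          using f_left[OF that(2), of "real n *\<^sub>R e"] by (simp add: scaleR_nonneg)
        then show ?thesis
          using inf_zero_mono t(2,4) \<open>0 \<le> w\<close> by blast
      qed
      then have "inf (t n) (inf p w) = 0"
        using inf_zero_mono[of "t n" w "t n" "inf p w"] \<open>0 \<le> p\<close> \<open>0 \<le> w\<close> t(2) by simp
      then have "t n + inf p w = sup (t n) (inf p w)"
        by (simp add: sup_eq_add_if_inf_zero)
      also have "\<dots> \<le> p"
        using p(2) by simp
      finally show ?thesis
        by (simp only: le_diff_eq)
    qed
    then have "p \<le> p - inf p w"
      using that p(1) by (intro p(3)) auto
    then have "inf p w \<le> 0"
      by (simp only: le_diff_eq add_le_same_cancel1)
    then show ?thesis
      using \<open>0 \<le> p\<close> \<open>0 \<le> w\<close> by (simp add: order_antisym)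
  qed
  have yz: "inf y (e - p) = 0"
  proof -
    define z where "z = inf y (e - p)"
    have z: "z \<in> F" "0 \<le> z" "z \<le> y" "z \<le> e - p"
      using assms p(1) \<open>p \<le> e\<close> by (simp_all add: z_def)
    \<comment> \<open>Adding \<open>z\<close>, which lies below both \<open>y\<close> and
      \<open>e - p\<close>, to \<open>t n\<close> does not exceed \<open>t (Suc n)\<close>; so
      \<open>p - z\<close> is still an upper bound.\<close>
    have "t n \<le> p - z" for n
    proof -
      have "t n + z \<le> real n *\<^sub>R y + y"
        using t(4) z(3) by (rule add_mono)
      moreover have "t n + z \<le> p + (e - p)"
        using p(2) z(4) by (rule add_mono)
      ultimately have "t n + z \<le> t (Suc n)"
        by (simp add: t_def scaleR_left_distrib add.commute)
      also have "\<dots> \<le> p"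
        by (rule p(2))
      finally show ?thesis
        by (simp only: le_diff_eq)
    qed
    then have "p \<le> p - z"
      using z(1) p(1) by (intro p(3)) auto
    then have "z \<le> 0"
      by (simp only: le_diff_eq add_le_same_cancel1)
    then show ?thesis
      using z(2) by (simp add: z_def order_antisym)
  qed
  have "(e - p) * y = 0"
    using yz by (simp add: mult_eq_zero_if_inf_zero inf_commute)
  then have "p * y = y"
    by (simp add: left_diff_distrib)
  moreover have "inf p (e - p) = 0"
    using disj[of "e - p"] yz p(1) F(3) by simp
  ultimately show thesis
    using that p(1) \<open>0 \<le> p\<close> \<open>p \<le> e\<close> disj by blast
qed

text \<open>Both products reduce to \<open>p * (a * p)\<close>, because
  \<open>p * (a * (e - p))\<close> and \<open>(e - p) * (a * p)\<close> are products of disjoint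
  elements.\<close>

lemma component_mult_commute:
  assumes "inf p (e - p) = 0" "0 \<le> a"
  shows "p * a = a * p"
proof -
  have p: "inf (e - p) p = 0"
    using assms(1) by (simp add: inf_commute)
  have "p * (a * (e - p)) = 0"
    using f_left[OF p assms(2)] by (simp add: mult_eq_zero_if_inf_zero inf_commute)
  moreover have "(e - p) * (a * p) = 0"
    using f_left[OF assms] by (simp add: mult_eq_zero_if_inf_zero inf_commute)
  ultimately show ?thesis
    by (simp add: algebra_simps)
qed

text \<open>
  Freudenthal's approximation is obtained by binary expansion; the digit \<open>p\<close> is the component of \<open>e\<close>
  carrying the positive part of \<open>x - e/2\<close>.
\<close>

lemma halving_step:
  assumes F: "riesz_subspace F" "dedekind_complete F" "e \<in> F"
    and x: "x \<in> F" "0 \<le> x" "x \<le> e"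
  obtains p where "p \<in> F" "0 \<le> p" "p \<le> e" "inf p (e - p) = 0"
    "0 \<le> x - (1/2) *\<^sub>R p" "x - (1/2) *\<^sub>R p \<le> (1/2) *\<^sub>R e"
proof -
  note [intro, simp] = riesz_subspaceD[OF F(1)]
  define u where "u = x - (1/2) *\<^sub>R e"
  have "u \<in> F"
    using F(3) x(1) by (simp add: u_def)
  have half: "(1/2) *\<^sub>R e + (1/2) *\<^sub>R e = e"
    by (simp flip: scaleR_left_distrib)
  obtain p where p: "p \<in> F" "0 \<le> p" "p \<le> e" "inf p (e - p) = 0" "p * pprt u = pprt u"
    "\<And>w. w \<in> F \<Longrightarrow> inf (pprt u) w = 0 \<Longrightarrow> inf p w = 0"
    using component_exists[OF F, of "pprt u"] \<open>u \<in> F\<close> by auto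
  \<comment> \<open>\<open>p\<close> annihilates the negative part of \<open>u\<close>, so
    multiplication by \<open>p\<close> cuts out exactly the positive part.\<close>
  have pu: "p * u = pprt u"
  proof -
    have "p * pprt (- u) = 0"
      using p(6)[of "pprt (- u)"] \<open>u \<in> F\<close>
      by (simp add: inf_pprt_pprt_minus mult_eq_zero_if_inf_zero)
    then have "p * (pprt u - pprt (- u)) = pprt u"
      using p(5) by (simp only: right_diff_distrib) simp
    then show ?thesis
      by (simp add: pprt_diff_pprt_minus)
  qed
  have "0 \<le> p * u"
    by (simp add: pu)
  then have "(1/2) *\<^sub>R p \<le> p * x"
    by (simp add: u_def right_diff_distrib)
  also have "\<dots> \<le> x"
    using mult_right_mono[OF p(3) x(2)] by simp
  finally have 1: "0 \<le> x - (1/2) *\<^sub>R p"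
    by simp
  have "u \<le> e - (1/2) *\<^sub>R e"
    unfolding u_def using x(3) by (rule diff_right_mono)
  also have "\<dots> = (1/2) *\<^sub>R e"
    using half by (simp only: diff_eq_eq)
  finally have "pprt u \<le> (1/2) *\<^sub>R e"
    by (simp add: pprt_def scaleR_nonneg)
  then have "p * pprt u \<le> p * ((1/2) *\<^sub>R e)"
    using p(2) by (rule mult_left_mono)
  then have "u \<le> (1/2) *\<^sub>R p"
    using p(5) pprt_ge_self[of u] by simp
  then have 2: "x - (1/2) *\<^sub>R p \<le> (1/2) *\<^sub>R e"
    unfolding u_def by (simp add: algebra_simps)
  show thesis
    using that[OF p(1-4) 1 2] .
qed

text \<open>Once the leading digit is removed, the remainder lies in \<open>[0, e/2]\<close>.
  Doubling returns it to \<open>[0, e]\<close>, and scaling back halves the error of the induction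
  hypothesis.\<close>

lemma freudenthal_approximation:
  assumes F: "riesz_subspace F" "dedekind_complete F" "e \<in> F"
    and C: "subspace C" "\<And>p. p \<in> F \<Longrightarrow> 0 \<le> p \<Longrightarrow> p \<le> e \<Longrightarrow> inf p (e - p) = 0 \<Longrightarrow> p \<in> C"
    and x: "x \<in> F" "0 \<le> x" "x \<le> e"
  shows "\<exists>s\<in>C. 0 \<le> x - s \<and> x - s \<le> (1/2)^n *\<^sub>R e"
  using x
proof (induction n arbitrary: x)
  case 0
  then show ?case
    using subspace_0[OF C(1)] by (intro bexI[of _ 0]) auto
next
  case (Suc n)
  note [intro, simp] = riesz_subspaceD[OF F(1)]
  obtain p where p: "p \<in> F" "0 \<le> p" "p \<le> e" "inf p (e - p) = 0"
    "0 \<le> x - (1/2) *\<^sub>R p" "x - (1/2) *\<^sub>R p \<le> (1/2) *\<^sub>R e"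
    using halving_step[OF F Suc.prems] by blast
  define y where "y = 2 *\<^sub>R (x - (1/2) *\<^sub>R p)"
  have "y \<in> F" "0 \<le> y"
    using Suc.prems p by (simp_all add: y_def scaleR_nonneg)
  moreover have "y \<le> e"
    using scaleR_left_mono[OF p(6), of 2] by (simp add: y_def)
  ultimately obtain s where s: "s \<in> C" "0 \<le> y - s" "y - s \<le> (1/2)^n *\<^sub>R e"
    using Suc.IH by blast
  have x: "x = (1/2) *\<^sub>R p + (1/2) *\<^sub>R y"
    by (simp add: y_def algebra_simps)
  have eq: "x - ((1/2) *\<^sub>R p + (1/2) *\<^sub>R s) = (1/2) *\<^sub>R (y - s)"
    unfolding x by (simp add: algebra_simps)
  have "0 \<le> (1/2) *\<^sub>R (y - s)"
    by (intro scaleR_nonneg s) simp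
  moreover have "(1/2) *\<^sub>R (y - s) \<le> (1/2) *\<^sub>R ((1/2)^n *\<^sub>R e)"
    by (intro scaleR_left_mono s) simp
  moreover have "(1/2) *\<^sub>R p + (1/2) *\<^sub>R s \<in> C"
    using C(2) p(1-4) s(1) subspace_add[OF C(1)] subspace_scale[OF C(1)] by simp
  ultimately show ?case
    by (intro bexI[of _ "(1/2) *\<^sub>R p + (1/2) *\<^sub>R s"]) (simp_all add: eq)
qed

text \<open>An induction principle for bounded nonnegative elements of \<open>F\<close>. It is used
  with the elements commuting with a fixed one, and with the multipliers satisfying the averaging
  identity.\<close>

lemma freudenthal_closure:
  assumes F: "riesz_subspace F" "dedekind_complete F" "e \<in> F"
    and C: "subspace C" "\<And>p. p \<in> F \<Longrightarrow> 0 \<le> p \<Longrightarrow> p \<le> e \<Longrightarrow> inf p (e - p) = 0 \<Longrightarrow> p \<in> C"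
      "\<And>x. x \<in> F \<Longrightarrow> (\<And>\<delta>. 0 < \<delta> \<Longrightarrow> \<exists>s\<in>C. \<bar>x - s\<bar> \<le> \<delta> *\<^sub>R e) \<Longrightarrow> x \<in> C"
    and x: "x \<in> F" "0 \<le> x" "x \<le> k *\<^sub>R e" "0 < k"
  shows "x \<in> C"
proof -
  note [intro, simp] = riesz_subspaceD[OF F(1)]
  have "(1/k) *\<^sub>R x \<le> (1/k) *\<^sub>R (k *\<^sub>R e)"
    using x by (intro scaleR_left_mono) auto
  then have y: "(1/k) *\<^sub>R x \<in> F" "0 \<le> (1/k) *\<^sub>R x" "(1/k) *\<^sub>R x \<le> e"
    using x by (simp_all add: scaleR_nonneg)
  have "(1/k) *\<^sub>R x \<in> C"
  proof (rule C(3)[OF y(1)])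
    fix \<delta> :: real assume "0 < \<delta>"
    then obtain n where "(1/2)^n < \<delta>"
      using real_arch_pow_inv[of \<delta> "1/2"] by auto
    obtain s where s: "s \<in> C" "0 \<le> (1/k) *\<^sub>R x - s" "(1/k) *\<^sub>R x - s \<le> (1/2)^n *\<^sub>R e"
      using freudenthal_approximation[OF F C(1,2) y] by blast
    have "(1/2)^n *\<^sub>R e \<le> \<delta> *\<^sub>R e"
      using \<open>(1/2)^n < \<delta>\<close> by (intro scaleR_right_mono) auto
    then show "\<exists>s\<in>C. \<bar>(1/k) *\<^sub>R x - s\<bar> \<le> \<delta> *\<^sub>R e"
      using s by (intro bexI[of _ s]) (auto simp only: abs_of_nonneg intro: order_trans)
  qed
  then have "k *\<^sub>R ((1/k) *\<^sub>R x) \<in> C"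
    by (rule subspace_scale[OF C(1)])
  then show ?thesis
    using x by simp
qed

text \<open>Meant for \<open>u = b - s\<close> with \<open>s\<close> commuting with
  \<open>a\<close>: the commutator of \<open>a\<close> and \<open>b\<close> is then that of
  \<open>a\<close> and the small remainder. Both \<open>a * v\<close> and \<open>v * a\<close> occur
  because \<open>v\<close> is not known to commute with \<open>a\<close>.\<close>

lemma commutator_le:
  assumes "0 \<le> a" "\<bar>u\<bar> \<le> (v::'a)"
  shows "a * u - u * a \<le> a * v + v * a"
proof -
  have "u \<le> v" "- u \<le> v"
    using assms(2) by (auto simp: abs_le_iff)
  then have "a * u \<le> a * v" "(- u) * a \<le> v * a"
    using assms(1) by (auto intro: mult_left_mono mult_right_mono simp del: mult_minus_left)
  from add_mono[OF this] show ?thesis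
    by simp
qed

lemma mult_commute_bounded:
  assumes "0 \<le> a" "0 \<le> b" "b \<le> k *\<^sub>R e" "0 < k"
  shows "a * b = b * (a::'a)"
proof -
  let ?C = "{b. a * b = b * a}"
  have "b \<in> ?C"
  proof (rule freudenthal_closure[of UNIV ?C b k])
    show "riesz_subspace (UNIV :: 'a set)"
      by (simp add: riesz_subspace_def)
    show "subspace ?C"
      by (auto simp: subspace_def algebra_simps)
    show "p \<in> ?C" if "inf p (e - p) = 0" for p
      using component_mult_commute[OF that assms(1)] by simp
    fix b assume ap: "\<exists>s\<in>?C. \<bar>b - s\<bar> \<le> \<delta> *\<^sub>R e" if "0 < \<delta>" for \<delta>
    have "a * b - b * a \<le> \<delta> *\<^sub>R (a + a)" "b * a - a * b \<le> \<delta> *\<^sub>R (a + a)" if "0 < \<delta>" for \<delta>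
    proof -
      obtain s where s: "a * s = s * a" "\<bar>b - s\<bar> \<le> \<delta> *\<^sub>R e" "\<bar>s - b\<bar> \<le> \<delta> *\<^sub>R e"
        using ap[OF \<open>0 < \<delta>\<close>] by (auto simp: abs_minus_commute)
      from commutator_le[OF assms(1) s(2)] commutator_le[OF assms(1) s(3)]
      show "a * b - b * a \<le> \<delta> *\<^sub>R (a + a)" "b * a - a * b \<le> \<delta> *\<^sub>R (a + a)"
        using s(1) by (simp_all add: algebra_simps)
    qed
    then have "a * b - b * a \<le> 0" "b * a - a * b \<le> 0"
      by (blast intro: archimedean_pos)+
    then show "b \<in> ?C"
      by simp
  qed (use assms dedekind_complete_UNIV in auto)
  then show ?thesis
    by simp
qed

lemma mult_commute_nonneg:
  assumes "0 \<le> a" "0 \<le> (b::'a)"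
  shows "a * b = b * a"
proof -
  have *: "a * b - b * a \<le> (1 / real (Suc k)) *\<^sub>R (a * (b * b) + (b * b) * a)"
    "b * a - a * b \<le> (1 / real (Suc k)) *\<^sub>R (a * (b * b) + (b * b) * a)" for k
  proof -
    define c where "c = inf b (real (Suc k) *\<^sub>R e)"
    have "a * c = c * a"
      using assms mult_commute_bounded[of a c "real (Suc k)"]
      by (simp add: c_def scaleR_nonneg)
    moreover have "c \<le> b"
      by (simp add: c_def)
    then have "\<bar>b - c\<bar> \<le> (1 / real (Suc k)) *\<^sub>R (b * b)"
      using truncation_error[OF assms(2), of k] unfolding c_def[symmetric]
      by (subst abs_of_nonneg) simp_all
    moreover from this have "\<bar>c - b\<bar> \<le> (1 / real (Suc k)) *\<^sub>R (b * b)"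
      by (simp add: abs_minus_commute)
    ultimately show
      "a * b - b * a \<le> (1 / real (Suc k)) *\<^sub>R (a * (b * b) + (b * b) * a)"
      "b * a - a * b \<le> (1 / real (Suc k)) *\<^sub>R (a * (b * b) + (b * b) * a)"
      using commutator_le[OF assms(1), of "b - c" "(1 / real (Suc k)) *\<^sub>R (b * b)"]
        commutator_le[OF assms(1), of "c - b" "(1 / real (Suc k)) *\<^sub>R (b * b)"]
      by (simp_all add: right_diff_distrib left_diff_distrib scaleR_right_distrib)
  qed
  have "a * b - b * a \<le> 0" "b * a - a * b \<le> 0"
    using * by (blast intro: archimedean_inverse)+
  then show ?thesis
    by simp
qed

lemma mult_commute: "x * y = y * (x::'a)"
proof -
  have "x * y = (pprt x - pprt (- x)) * (pprt y - pprt (- y))"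
    by (simp add: pprt_diff_pprt_minus)
  also have "\<dots> = (pprt y - pprt (- y)) * (pprt x - pprt (- x))"
    using mult_commute_nonneg[of "pprt x" "pprt y"] mult_commute_nonneg[of "pprt x" "pprt (- y)"]
      mult_commute_nonneg[of "pprt (- x)" "pprt y"] mult_commute_nonneg[of "pprt (- x)" "pprt (- y)"]
    by (simp add: algebra_simps)
  also have "\<dots> = y * x"
    by (simp add: pprt_diff_pprt_minus)
  finally show ?thesis .
qed

lemma mult_left_commute: "x * (y * z) = y * (x * (z::'a))"
  by (metis mult.assoc mult_commute)

end


section \<open>The averaging property\<close>

locale T_universal_triple = unital_f_algebra e for e :: "'a::f_algebra" +
  fixes E :: "'a set" and T :: "'a \<Rightarrow> 'a"
  assumes completion: "universal_completion_of E"
    and triple: "conditional_riesz_triple E e T"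
    and T_univ_complete: "T_universally_complete E T"
begin

abbreviation R :: "'a set" where "R \<equiv> T ` E"

lemma riesz_E: "riesz_subspace E" and riesz_R: "riesz_subspace R"
  and dedekind_E: "dedekind_complete E" and dedekind_R: "dedekind_complete R"
  and T_idem [simp]: "x \<in> E \<Longrightarrow> T (T x) = T x" and T_e [simp]: "T e = e"
  and T_strict: "x \<in> E \<Longrightarrow> 0 < x \<Longrightarrow> 0 < T x"
  and T_in_E [simp, intro]: "x \<in> E \<Longrightarrow> T x \<in> E" and e_in_E [simp, intro]: "e \<in> E"
  and T_add: "x \<in> E \<Longrightarrow> y \<in> E \<Longrightarrow> T (x + y) = T x + T y"
  and T_scaleR: "x \<in> E \<Longrightarrow> T (c *\<^sub>R x) = c *\<^sub>R T x"
  using triple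
  by (auto simp: conditional_riesz_triple_def linear_op_def weak_order_unit_def)

lemmas E_closed [simp, intro] = riesz_subspaceD[OF riesz_E]
lemmas R_closed = riesz_subspaceD[OF riesz_R]

section \<open>Order properties of \<open>T\<close> on \<open>E\<close>\<close>

lemma T_diff: "x \<in> E \<Longrightarrow> y \<in> E \<Longrightarrow> T (x - y) = T x - T y"
  using T_add[of "x - y" y] by (simp add: eq_diff_eq)

lemma T_0 [simp]: "T 0 = 0"
  using T_diff[of 0 0] by simp

lemma T_minus: "x \<in> E \<Longrightarrow> T (- x) = - T x"
  using T_diff[of 0 x] by simp

lemma T_nonneg: "x \<in> E \<Longrightarrow> 0 \<le> x \<Longrightarrow> 0 \<le> T x"
  using T_strict[of x] by (cases "x = 0") (auto simp: less_le)

lemma T_mono: "x \<in> E \<Longrightarrow> y \<in> E \<Longrightarrow> x \<le> y \<Longrightarrow> T x \<le> T y"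
  using T_nonneg[of "y - x"] by (simp add: T_diff)

lemma T_eq_0: "x \<in> E \<Longrightarrow> 0 \<le> x \<Longrightarrow> T x \<le> 0 \<Longrightarrow> x = 0"
  using T_strict[of x] by (metis less_le_not_le order_less_le)

lemma abs_T_le: "x \<in> E \<Longrightarrow> \<bar>T x\<bar> \<le> T \<bar>x\<bar>"
  using T_mono[of x "\<bar>x\<bar>"] T_mono[of "- x" "\<bar>x\<bar>"]
  by (simp add: T_minus abs_le_iff abs_ge_minus_self abs_ge_self)

lemma R_subset_E: "g \<in> R \<Longrightarrow> g \<in> E"
  by auto

lemma T_R: "g \<in> R \<Longrightarrow> T g = g"
  by auto

lemma e_in_R [simp, intro]: "e \<in> R"
  by (rule image_eqI[of _ _ e]) auto

lemma order_continuity: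
  assumes "D \<subseteq> E" "D \<noteq> {}" "\<And>x y. x \<in> D \<Longrightarrow> y \<in> D \<Longrightarrow> \<exists>z\<in>D. z \<le> x \<and> z \<le> y"
    "\<And>d. d \<in> D \<Longrightarrow> 0 \<le> d" "\<And>v. v \<in> E \<Longrightarrow> (\<And>d. d \<in> D \<Longrightarrow> v \<le> d) \<Longrightarrow> v \<le> 0"
    and "w \<in> E" "\<And>d. d \<in> D \<Longrightarrow> w \<le> T d"
  shows "w \<le> 0"
proof -
  have "isGlb E D 0"
    using assms(4,5) by (auto simp: isGlb_iff)
  moreover have "order_continuous E T"
    using triple by (simp add: conditional_riesz_triple_def)
  ultimately have "isGlb E (T ` D) 0"
    using assms(1-3) unfolding order_continuous_def by blast
  then show ?thesis
    using assms(6,7) by (auto simp: isGlb_iff)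
qed

text \<open>The bound by multiples of \<open>b\<close> certifies that the sequence decreases to 0.
  Only the Archimedean property of the ambient space is involved, so \<open>b\<close> may lie
  outside \<open>E\<close>.\<close>

lemma order_continuity_seq:
  assumes "\<And>k::nat. d k \<in> E" "\<And>k. 0 \<le> d k" "\<And>k. d (Suc k) \<le> d k"
    "\<And>k. d k \<le> (1 / real (Suc k)) *\<^sub>R b"
    and "w \<in> E" "\<And>k. w \<le> T (d k)"
  shows "w \<le> 0"
proof (rule order_continuity[of "range d"])
  have anti: "d n \<le> d m" if "m \<le> n" for m n
    using lift_Suc_antimono_le[of d, OF assms(3) that] .
  show "\<exists>z\<in>range d. z \<le> x \<and> z \<le> y" if xy: "x \<in> range d" "y \<in> range d" for x y
  proof -
    obtain m n where "x = d m" "y = d n"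
      using xy by blast
    then show ?thesis
      using anti[of m "max m n"] anti[of n "max m n"] by auto
  qed
  show "v \<le> 0" if "\<And>x. x \<in> range d \<Longrightarrow> v \<le> x" for v
    using that order_trans[OF _ assms(4)] by (intro archimedean_inverse[of v b]) blast
qed (use assms in auto)

lemma T_univ_completeE:
  assumes "A \<subseteq> E" "A \<noteq> {}" "\<And>x y. x \<in> A \<Longrightarrow> y \<in> A \<Longrightarrow> \<exists>z\<in>A. x \<le> z \<and> y \<le> z"
    "\<And>a. a \<in> A \<Longrightarrow> T a \<le> u"
  obtains s where "isLub E A s"
proof -
  have "isUb UNIV (T ` A) u"
    using assms(4) by (auto simp: isUb_def setle_def)
  with assms(1-3) have
    *: "A \<subseteq> E \<and> A \<noteq> {} \<and> (\<forall>x\<in>A. \<forall>y\<in>A. \<exists>z\<in>A. x \<le> z \<and> y \<le> z) \<and> (\<exists>u. isUb UNIV (T ` A) u)"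
    by blast
  show thesis
    using T_univ_complete[unfolded T_universally_complete_def, THEN spec, THEN mp, OF *] that by blast
qed

text \<open>\<open>x\<close> equals the supremum \<open>s\<close>, formed in \<open>E\<close>, of
  the elements of \<open>E\<close> in \<open>[0, x]\<close>: order density excludes a gap on either
  side.\<close>

lemma E_ideal_nonneg:
  assumes "0 \<le> x" "x \<le> y" "y \<in> E"
  shows "x \<in> E"
proof -
  have dense: "\<exists>w\<in>E. 0 < w \<and> w \<le> d" if "0 < d" for d
    using completion that by (auto simp: universal_completion_of_def order_dense_def)
  define A where "A = {z\<in>E. 0 \<le> z \<and> z \<le> x}"
  have "0 \<in> A"
    using assms by (simp add: A_def)
  moreover have "a \<le> y" if "a \<in> A" for a
    using that assms by (auto simp: A_def)
  ultimately obtain s where "isLub E A s"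
    using dedekind_completeE[OF dedekind_E, of A y] assms(3) A_def by blast
  then have s: "s \<in> E" "\<And>a. a \<in> A \<Longrightarrow> a \<le> s" "\<And>u. u \<in> E \<Longrightarrow> (\<And>a. a \<in> A \<Longrightarrow> a \<le> u) \<Longrightarrow> s \<le> u"
    by (auto simp: isLub_iff)
  have "x \<le> s"
  proof (rule ccontr)
    assume "\<not> x \<le> s"
    then have "inf x s \<noteq> x"
      by (metis inf.cobounded2)
    then have "0 < x - inf x s"
      by (simp add: less_le del: diff_inf_eq_sup)
    then obtain w where w: "w \<in> E" "0 < w" "w \<le> x - inf x s"
      using dense by blast
    \<comment> \<open>A multiple of \<open>w\<close> below \<open>x\<close> belongs to
      \<open>A\<close>, hence lies below \<open>s\<close>, and so \<open>w\<close>, which fits into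
      the gap, can be added once more.\<close>
    have "real n *\<^sub>R w \<le> x" for n
    proof (induction n)
      case (Suc n)
      then have "real n *\<^sub>R w \<in> A"
        using w by (simp add: A_def scaleR_nonneg)
      then have "real n *\<^sub>R w \<le> inf x s"
        using s(2) by (simp add: A_def)
      then have "real n *\<^sub>R w + w \<le> inf x s + (x - inf x s)"
        using w(3) by (rule add_mono)
      then show ?case
        by (simp add: scaleR_left_distrib add.commute del: diff_inf_eq_sup)
    qed (use assms in simp)
    then have "w \<le> 0"
      by (rule archimedean)
    then show False
      using w(2) by simp
  qed
  moreover have "\<not> x < s"
  proof
    assume "x < s"
    then obtain w where w: "w \<in> E" "0 < w" "w \<le> s - x"
      using dense[of "s - x"] by auto
    have "s \<le> s - w"
    proof (rule s(3))
      fix a assume "a \<in> A"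
      then have "a \<le> x"
        by (simp add: A_def)
      also have "x \<le> s - w"
        using w(3) by (simp add: algebra_simps)
      finally show "a \<le> s - w" .
    qed (use s w in simp)
    then show False
      using w(2) by (simp add: le_diff_eq)
  qed
  ultimately show ?thesis
    using s(1) by (simp add: order_less_le)
qed

lemma E_ideal:
  assumes "\<bar>x\<bar> \<le> y" "y \<in> E"
  shows "x \<in> E"
proof -
  have "pprt x \<le> \<bar>x\<bar>" "pprt (- x) \<le> \<bar>x\<bar>"
    by (simp_all add: abs_eq_pprt_add)
  then have "pprt x \<in> E" "pprt (- x) \<in> E"
    using assms by (meson E_ideal_nonneg order_trans zero_le_pprt)+
  then have "pprt x - pprt (- x) \<in> E"
    by blast
  then show ?thesis
    by (simp only: pprt_diff_pprt_minus)
qed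

lemma mult_bounded_in_E:
  assumes "\<bar>g\<bar> \<le> k *\<^sub>R e" "f \<in> E"
  shows "g * f \<in> E"
proof (rule E_ideal)
  have "\<bar>g * f\<bar> \<le> \<bar>g\<bar> * \<bar>f\<bar>"
    by (rule abs_le_mult)
  also have "\<dots> \<le> (k *\<^sub>R e) * \<bar>f\<bar>"
    using assms(1) by (rule mult_right_mono) simp
  finally show "\<bar>g * f\<bar> \<le> k *\<^sub>R \<bar>f\<bar>"
    by simp
qed (use assms in simp)

lemma mult_unit_interval_in_E: "0 \<le> p \<Longrightarrow> p \<le> e \<Longrightarrow> f \<in> E \<Longrightarrow> p * f \<in> E"
  using mult_bounded_in_E[of p 1 f] by simp

lemma truncation_mono: "inf x (real (Suc k) *\<^sub>R e) \<le> inf x (real (Suc (Suc k)) *\<^sub>R e)"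
  by (intro inf_mono scaleR_right_mono) auto

lemma T_truncation_limit:
  assumes "f \<in> E" "0 \<le> f" "w \<in> E" "\<And>k. w \<le> T (f - inf f (real (Suc k) *\<^sub>R e))"
  shows "w \<le> 0"
proof (rule order_continuity_seq)
  fix k
  show "f - inf f (real (Suc k) *\<^sub>R e) \<in> E"
    using assms(1) e_in_E E_closed by presburger
  show "0 \<le> f - inf f (real (Suc k) *\<^sub>R e)"
    by (simp del: diff_inf_eq_sup)
  show "f - inf f (real (Suc (Suc k)) *\<^sub>R e) \<le> f - inf f (real (Suc k) *\<^sub>R e)"
    using truncation_mono[of f k] by (rule diff_left_mono)
  show "f - inf f (real (Suc k) *\<^sub>R e) \<le> (1 / real (Suc k)) *\<^sub>R (f * f)"
    using assms(2) by (rule truncation_error)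
qed (use assms in auto)

text \<open>Since \<open>p\<close> is fixed by \<open>T\<close>, the bound on \<open>f\<close> gives
  \<open>T (p * f) \<le> k p\<close>, which \<open>e - p\<close> annihilates.\<close>

lemma T_mult_component_bounded:
  assumes p: "p \<in> R" "0 \<le> p" "p \<le> e" "inf p (e - p) = 0"
    and f: "f \<in> E" "0 \<le> f" "f \<le> k *\<^sub>R e"
  shows "p * T (p * f) = T (p * f)"
proof -
  have pf: "p * f \<in> E" "p \<in> E"
    using p f mult_unit_interval_in_E by auto
  have "p * f \<le> p * (k *\<^sub>R e)"
    using f(3) p(2) by (rule mult_left_mono)
  then have "T (p * f) \<le> T (k *\<^sub>R p)"
    using pf by (intro T_mono) auto
  also have "T (k *\<^sub>R p) = k *\<^sub>R p"
    by (simp only: T_scaleR[OF pf(2)] T_R[OF p(1)])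
  finally have "(e - p) * T (p * f) \<le> (e - p) * (k *\<^sub>R p)"
    using p(3) by (intro mult_left_mono) simp_all
  also have "(e - p) * (k *\<^sub>R p) = 0"
    using mult_eq_zero_if_inf_zero[of "e - p" p] p(4) by (simp add: inf_commute)
  finally have "(e - p) * T (p * f) = 0"
    using p(2,3) f(2) pf(1) by (intro order_antisym) (simp_all add: mult_nonneg_nonneg T_nonneg)
  then show ?thesis
    by (simp add: left_diff_distrib)
qed

text \<open>For bounded \<open>c\<close>, split \<open>c = p * c + (e - p) * c\<close>; the
  preceding lemma for the complementary component \<open>e - p\<close> shows that the second summand
  contributes nothing to \<open>p * T c\<close>.\<close>

lemma T_mult_component:
  assumes p: "p \<in> R" "0 \<le> p" "p \<le> e" "inf p (e - p) = 0" and f: "f \<in> E" "0 \<le> f"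
  shows "T (p * f) = p * T f"
proof -
  have bounded: "T (p * c) = p * T c" if c: "c \<in> E" "0 \<le> c" "c \<le> k *\<^sub>R e" for c k
  proof -
    have q: "e - p \<in> R" "0 \<le> e - p" "e - p \<le> e" "inf (e - p) (e - (e - p)) = 0"
      using p R_closed(3)[OF e_in_R p(1)] by (simp_all add: inf_commute)
    have in_E: "p * c \<in> E" "(e - p) * c \<in> E"
      using mult_unit_interval_in_E p q c by auto
    have "p * T ((e - p) * c) = p * ((e - p) * T ((e - p) * c))"
      using T_mult_component_bounded[OF q c] by simp
    also have "\<dots> = 0"
      using mult_eq_zero_if_inf_zero[OF p(4)] by (simp flip: mult.assoc)
    finally have "p * T (p * c + (e - p) * c) = p * T (p * c)"
      using in_E by (simp only: T_add distrib_left) simp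
    moreover have "p * c + (e - p) * c = c"
      by (simp add: algebra_simps)
    ultimately show ?thesis
      using T_mult_component_bounded[OF p c] by simp
  qed
  have *: "T (p * f) - p * T f \<le> T (f - c) \<and> p * T f - T (p * f) \<le> T (f - c)"
    if c: "c = inf f (real (Suc k) *\<^sub>R e)" for c k
  proof -
    have "c \<in> E" "0 \<le> c" "c \<le> real (Suc k) *\<^sub>R e" "c \<le> f"
      using f unfolding c by (auto intro!: le_infI scaleR_nonneg)
    then have pc: "T (p * c) = p * T c"
      by (intro bounded)
    define d where "d = f - c"
    have d: "d \<in> E" "0 \<le> d"
      using f \<open>c \<in> E\<close> \<open>c \<le> f\<close> by (simp_all add: d_def)
    have in_E: "p * c \<in> E" "p * d \<in> E"
      using mult_unit_interval_in_E p d \<open>c \<in> E\<close> by auto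
    have "T (p * f) - p * T f = T (p * d) - p * T d"
    proof -
      have f: "f = c + d"
        by (simp add: d_def)
      show ?thesis
        unfolding f using in_E d(1) \<open>c \<in> E\<close> pc by (simp add: distrib_left T_add)
    qed
    \<comment> \<open>Both \<open>T (p * d)\<close> and \<open>p * T d\<close> lie in
      \<open>[0, T d]\<close>, so their difference is at most \<open>T d\<close> in absolute
      value.\<close>
    moreover have "0 \<le> p * T d" "0 \<le> T (p * d)" "p * T d \<le> T d" "T (p * d) \<le> T d"
      using p d in_E T_nonneg[OF d] mult_right_mono[OF p(3), of "T d"] mult_right_mono[OF p(3) d(2)]
      by (auto intro!: mult_nonneg_nonneg T_nonneg T_mono)
    ultimately have "T (p * f) - p * T f \<le> T d" "- (T (p * f) - p * T f) \<le> T d"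
      by (auto intro: order_trans[OF diff_left_mono[of 0]] simp del: minus_diff_eq
        simp: order_trans[OF diff_left_mono[of 0]] minus_diff_eq[of "T (p * d)"])
    then show ?thesis
      by (simp add: d_def)
  qed
  have "T (p * f) - p * T f \<in> E"
    using mult_unit_interval_in_E[OF p(2,3)] f by auto
  moreover from this have "p * T f - T (p * f) \<in> E"
    using E_closed(4) by fastforce
  ultimately have "T (p * f) - p * T f \<le> 0" "p * T f - T (p * f) \<le> 0"
    using * by (blast intro: T_truncation_limit[OF f])+
  then show ?thesis
    by simp
qed

lemma nonneg_to_all:
  assumes "\<And>f. f \<in> E \<Longrightarrow> 0 \<le> f \<Longrightarrow> g * f \<in> E \<and> T (g * f) = g * T f" and "f \<in> E"
  shows "g * f \<in> E \<and> T (g * f) = g * T f"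
proof -
  let ?p = "pprt f" and ?n = "pprt (- f)"
  have p: "?p \<in> E" "g * ?p \<in> E" "T (g * ?p) = g * T ?p"
    and n: "?n \<in> E" "g * ?n \<in> E" "T (g * ?n) = g * T ?n"
    using assms(1)[of ?p] assms(1)[of ?n] assms(2) by auto
  have "g * (?p - ?n) \<in> E \<and> T (g * (?p - ?n)) = g * T (?p - ?n)"
    using p n by (simp add: right_diff_distrib T_diff)
  then show ?thesis
    by (simp only: pprt_diff_pprt_minus)
qed

lemma T_mult_bounded:
  assumes "g \<in> R" "0 \<le> g" "g \<le> k *\<^sub>R e" "0 < k" "f \<in> E"
  shows "g * f \<in> E \<and> T (g * f) = g * T f"
proof -
  \<comment> \<open>Membership of \<open>g * f\<close> in \<open>E\<close> is carried along, since
    \<open>T\<close> can be split over sums only there.\<close>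
  let ?C = "{g. \<forall>f\<in>E. g * f \<in> E \<and> T (g * f) = g * T f}"
  have "g \<in> ?C"
  proof (rule freudenthal_closure[OF riesz_R dedekind_R e_in_R, where k = k])
    show "subspace ?C"
      by (auto simp: subspace_def algebra_simps T_add T_scaleR)
    show "p \<in> ?C" if p: "p \<in> R" "0 \<le> p" "p \<le> e" "inf p (e - p) = 0" for p
      using T_mult_component[OF p] mult_unit_interval_in_E[OF p(2,3)] nonneg_to_all by blast
    show "g \<in> ?C" if "g \<in> R" and ap: "\<And>\<delta>. 0 < \<delta> \<Longrightarrow> \<exists>s\<in>?C. \<bar>g - s\<bar> \<le> \<delta> *\<^sub>R e" for g
    proof -
      have "g * f \<in> E \<and> T (g * f) = g * T f" if f: "f \<in> E" for f
      proof -
        have gf: "g * f \<in> E" if "s \<in> ?C" "\<bar>g - s\<bar> \<le> \<delta> *\<^sub>R e" for s \<delta>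
        proof -
          have "(g - s) * f + s * f \<in> E"
            using mult_bounded_in_E[OF that(2) f] that(1) f by blast
          then show ?thesis
            by (simp add: left_diff_distrib)
        qed
        have "\<bar>T (g * f) - g * T f\<bar> \<le> \<delta> *\<^sub>R (T \<bar>f\<bar> + \<bar>T f\<bar>)" if "0 < \<delta>" for \<delta>
        proof -
          obtain s where s: "s \<in> ?C" "\<bar>g - s\<bar> \<le> \<delta> *\<^sub>R e"
            using ap[OF \<open>0 < \<delta>\<close>] by blast
          define r where "r = g - s"
          have r: "\<bar>r * x\<bar> \<le> \<delta> *\<^sub>R \<bar>x\<bar>" for x
            using order_trans[OF abs_le_mult mult_right_mono[OF s(2) abs_ge_zero]]
            by (simp add: r_def)
          have rf: "r * f \<in> E"
            using mult_bounded_in_E[OF s(2) f] by (simp add: r_def)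
          have g: "g = s + r"
            by (simp add: r_def)
          have "T (g * f) - g * T f = T (r * f) - r * T f"
            unfolding g using s(1) rf f by (simp add: distrib_right T_add)
          then have "\<bar>T (g * f) - g * T f\<bar> \<le> \<bar>T (r * f)\<bar> + \<bar>r * T f\<bar>"
            by (metis abs_triangle_ineq4)
          also have "\<bar>r * T f\<bar> \<le> \<delta> *\<^sub>R \<bar>T f\<bar>"
            by (rule r)
          also have "\<bar>T (r * f)\<bar> \<le> T \<bar>r * f\<bar>"
            using rf by (rule abs_T_le)
          also have "T \<bar>r * f\<bar> \<le> T (\<delta> *\<^sub>R \<bar>f\<bar>)"
            using rf f by (intro T_mono r) auto
          finally show ?thesis
            using f by (simp add: T_scaleR scaleR_right_distrib)
        qed
        then have "\<bar>T (g * f) - g * T f\<bar> \<le> 0"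
          by (rule archimedean_pos)
        then have "T (g * f) = g * T f"
          by simp
        then show ?thesis
          using gf[of _ 1] ap[of 1] by auto
      qed
      then show ?thesis
        by blast
    qed
  qed (use assms in auto)
  then show ?thesis
    using assms by blast
qed

text \<open>
  For unbounded \<open>g\<close> it is the \<open>T\<close>-universal completeness that puts \<open>g * f\<close> into \<open>E\<close>: the images
  \<open>T ((g \<sqinter> k e) * f) = (g \<sqinter> k e) * T f\<close> are bounded by \<open>g * T f\<close>.
\<close>

lemma T_mult_nonneg_if_in_E:
  assumes g: "g \<in> R" "0 \<le> g" and f: "f \<in> E" "0 \<le> f"
  shows "g * f \<in> E" "g * T f \<in> E \<Longrightarrow> T (g * f) = g * T f"
proof -
  define c where "c k = inf g (real (Suc k) *\<^sub>R e)" for k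
  have c: "c k \<in> R" "0 \<le> c k" "c k \<le> real (Suc k) *\<^sub>R e" "c k \<le> g" "c k \<le> c (Suc k)" for k
    using g(2) R_closed(7)[OF g(1) R_closed(5)[OF e_in_R]] truncation_mono[of g k]
    unfolding c_def by (auto intro!: le_infI scaleR_nonneg)
  have cf: "c k * f \<in> E" "T (c k * f) = c k * T f" for k
    using T_mult_bounded[OF c(1-3) _ f(1)] by auto
  have err: "g - c k \<le> (1 / real (Suc k)) *\<^sub>R (g * g)" for k
    using truncation_error[OF g(2)] by (simp only: c_def)
  have mono: "c m \<le> c n" if "m \<le> n" for m n
    using lift_Suc_mono_le[of c, OF c(5) that] .
  have err_mult: "g * x - c k * x \<le> (1 / real (Suc k)) *\<^sub>R (g * g * x)" if "0 \<le> x" for k x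
    using mult_right_mono[OF err that] by (simp add: left_diff_distrib)
  obtain s where "isLub E (range (\<lambda>k. c k * f)) s"
  proof (rule T_univ_completeE[of "range (\<lambda>k. c k * f)" "g * T f"])
    show "\<exists>z\<in>range (\<lambda>k. c k * f). x \<le> z \<and> y \<le> z"
      if xy: "x \<in> range (\<lambda>k. c k * f)" "y \<in> range (\<lambda>k. c k * f)" for x y
    proof -
      obtain m n where "x = c m * f" "y = c n * f"
        using xy by blast
      then show ?thesis
        using mono[of m "max m n"] mono[of n "max m n"] f(2)
        by (intro bexI[of _ "c (max m n) * f"]) (auto intro: mult_right_mono)
    qed
    show "T a \<le> g * T f" if "a \<in> range (\<lambda>k. c k * f)" for a
      using that c(4) T_nonneg[OF f] by (auto simp: cf intro!: mult_right_mono)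
  qed (use cf(1) in auto)
  then have s: "s \<in> E" "\<And>k. c k * f \<le> s"
    by (auto simp: isLub_iff)
  \<comment> \<open>The supremum \<open>s\<close> is formed in \<open>E\<close>, so it is known only
    to dominate the truncated products. The vanishing truncation error makes it dominate
    \<open>g * f\<close>, and the ideal property then applies.\<close>
  have "g * f - s \<le> 0"
  proof (rule archimedean_inverse)
    fix k
    show "g * f - s \<le> (1 / real (Suc k)) *\<^sub>R (g * g * f)"
      using order_trans[OF diff_left_mono[OF s(2)[of k]] err_mult[OF f(2)]] by blast
  qed
  then have gf: "g * f \<in> E"
    using E_ideal_nonneg[OF mult_nonneg_nonneg[OF g(2) f(2)] _ s(1)] by simp
  define d where "d k = g * f - c k * f" for k
  have d: "d k \<in> E" "0 \<le> d k" "d (Suc k) \<le> d k" for k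
    using gf cf(1) c(4) c(5) f(2) by (auto simp: d_def intro: mult_right_mono)
  \<comment> \<open>Order continuity in \<open>E\<close> bounds only elements of \<open>E\<close>,
    hence the condition on \<open>g * T f\<close>.\<close>
  have "T (g * f) - g * T f \<le> 0" if "g * T f \<in> E"
  proof (rule order_continuity_seq[OF d err_mult[OF f(2), folded d_def]])
    show "T (g * f) - g * T f \<in> E"
      using gf that by blast
    fix k
    show "T (g * f) - g * T f \<le> T (d k)"
      using gf cf c(4)[of k] T_nonneg[OF f] by (simp add: d_def T_diff diff_left_mono mult_right_mono)
  qed
  moreover have "g * T f - T (g * f) \<le> 0"
  proof (rule archimedean_inverse)
    fix k
    have "c k * T f \<le> T (g * f)"
      using gf cf c(4)[of k] f(2) by (auto simp flip: cf(2) intro!: T_mono mult_right_mono)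
    then show "g * T f - T (g * f) \<le> (1 / real (Suc k)) *\<^sub>R (g * g * T f)"
      using order_trans[OF diff_left_mono[of "c k * T f"] err_mult[OF T_nonneg[OF f]]] by blast
  qed
  ultimately show "g * T f \<in> E \<Longrightarrow> T (g * f) = g * T f"
    by simp
  show "g * f \<in> E"
    by (rule gf)
qed

text \<open>That \<open>g * T f\<close> lies in \<open>E\<close> is the first half of the preceding
  lemma, applied to \<open>T f\<close>.\<close>

lemma T_mult_nonneg:
  assumes "g \<in> R" "0 \<le> g" and "f \<in> E" "0 \<le> f"
  shows "g * f \<in> E \<and> T (g * f) = g * T f"
  using T_mult_nonneg_if_in_E[OF assms] T_mult_nonneg_if_in_E(1)[OF assms(1,2), of "T f"] T_nonneg assms
  by blast

lemma R_mult:
  assumes "g \<in> R" "f \<in> E"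
  shows "g * f \<in> E" "T (g * f) = g * T f"
proof -
  have *: "g * f \<in> E \<and> T (g * f) = g * T f" if "g \<in> R" "0 \<le> g" for g
    using T_mult_nonneg[OF that] assms(2) by (rule nonneg_to_all)
  let ?p = "pprt g" and ?n = "pprt (- g)"
  have "(?p - ?n) * f \<in> E" "T ((?p - ?n) * f) = (?p - ?n) * T f"
    using *[of ?p] *[of ?n] R_closed(4,8) assms
    by (simp_all add: left_diff_distrib T_diff)
  then show "g * f \<in> E" "T (g * f) = g * T f"
    by (simp_all only: pprt_diff_pprt_minus)
qed

lemma R_mult_R: "g \<in> R \<Longrightarrow> h \<in> R \<Longrightarrow> g * h \<in> R"
  using R_mult[of g h] R_subset_E[of h] T_R[of h] by (metis image_eqI)


section \<open>Multipliers in L-infinity\<close>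

abbreviation L :: "'a set" where "L \<equiv> L_infty E T"

lemma L_E: "f \<in> L \<Longrightarrow> f \<in> E"
  by (simp add: L_infty_def)

lemma L_I: "r \<in> R \<Longrightarrow> \<bar>f\<bar> \<le> r \<Longrightarrow> f \<in> L"
  unfolding L_infty_def using E_ideal[of f r] R_subset_E[of r] order_trans[OF abs_ge_zero[of f]] by blast

lemma L_bound:
  assumes "f \<in> L"
  obtains r where "r \<in> R" "\<bar>f\<bar> \<le> r"
  using assms by (auto simp: L_infty_def)

lemma L_add:
  assumes "f \<in> L" "g \<in> L"
  shows "f + g \<in> L"
proof -
  obtain r s where rs: "r \<in> R" "\<bar>f\<bar> \<le> r" "s \<in> R" "\<bar>g\<bar> \<le> s"
    using L_bound assms by metis
  show ?thesis
    using rs by (intro L_I[OF R_closed(2)] order_trans[OF abs_triangle_ineq add_mono])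
qed

lemma L_R_mult:
  assumes "g \<in> R" "f \<in> L"
  shows "g * f \<in> L"
proof -
  obtain r where r: "r \<in> R" "\<bar>f\<bar> \<le> r"
    using L_bound[OF assms(2)] .
  have "\<bar>g * f\<bar> \<le> \<bar>g\<bar> * r"
    using order_trans[OF abs_le_mult mult_left_mono[OF r(2)], of g] by simp
  then show ?thesis
    by (rule L_I[OF R_mult_R[OF R_closed(9)[OF assms(1)] r(1)]])
qed

lemma L_scaleR: "f \<in> L \<Longrightarrow> c *\<^sub>R f \<in> L"
  using L_R_mult[of "c *\<^sub>R e" f] R_closed(5)[OF e_in_R] by simp

lemma L_minus: "f \<in> L \<Longrightarrow> - f \<in> L"
  using L_scaleR[of f "- 1"] by simp

lemma L_diff: "f \<in> L \<Longrightarrow> g \<in> L \<Longrightarrow> f - g \<in> L"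
  using L_add[of f "- g"] L_minus[of g] by simp

lemma R_L: "r \<in> R \<Longrightarrow> r \<in> L"
  using L_I[of "\<bar>r\<bar>" r] R_closed(9) by simp

lemma L_pprt: "f \<in> L \<Longrightarrow> pprt f \<in> L"
proof -
  assume "f \<in> L"
  then obtain r where r: "r \<in> R" "\<bar>f\<bar> \<le> r"
    by (rule L_bound)
  have "\<bar>pprt f\<bar> \<le> \<bar>f\<bar>"
    by (simp add: abs_eq_pprt_add[of f])
  then show ?thesis
    using L_I[OF r(1)] r(2) order_trans by metis
qed

lemma L_sup: "f \<in> L \<Longrightarrow> g \<in> L \<Longrightarrow> sup f g \<in> L"
  by (simp only: sup_eq_add_pprt L_add L_diff L_pprt)

lemma L_inf: "f \<in> L \<Longrightarrow> g \<in> L \<Longrightarrow> inf f g \<in> L"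
  by (simp only: inf_eq_diff_pprt L_diff L_pprt)

lemma abs_mult_bound: "\<bar>f\<bar> \<le> r \<Longrightarrow> \<bar>f * x\<bar> \<le> r * \<bar>x::'a\<bar>"
  by (rule order_trans[OF abs_le_mult mult_right_mono]) auto

lemma L_mult_E:
  assumes "f \<in> L" "x \<in> E"
  shows "f * x \<in> E"
proof -
  obtain r where r: "r \<in> R" "\<bar>f\<bar> \<le> r"
    using L_bound[OF assms(1)] .
  show ?thesis
    using E_ideal[OF abs_mult_bound[OF r(2)]] R_mult(1)[OF r(1)] assms(2) by simp
qed

lemma T_mult_bound:
  assumes "r \<in> R" "\<bar>f\<bar> \<le> r" "x \<in> E"
  shows "\<bar>T (f * x)\<bar> \<le> r * T \<bar>x\<bar>"
proof -
  have fx: "f * x \<in> E"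
    using L_mult_E[OF L_I[OF assms(1,2)] assms(3)] .
  then have "\<bar>T (f * x)\<bar> \<le> T \<bar>f * x\<bar>"
    by (rule abs_T_le)
  also have "\<dots> \<le> T (r * \<bar>x\<bar>)"
    using abs_mult_bound[OF assms(2)] R_mult(1)[OF assms(1)] fx assms(3) by (intro T_mono) auto
  also have "\<dots> = r * T \<bar>x\<bar>"
    using R_mult(2)[OF assms(1)] assms(3) by simp
  finally show ?thesis .
qed

lemma mult_le_self: "0 \<le> p \<Longrightarrow> p \<le> e \<Longrightarrow> 0 \<le> x \<Longrightarrow> x * p \<le> x"
  using mult_left_mono[of p e x] by simp

text \<open>With \<open>d = f - g\<close>, the test element \<open>x\<close> is disjoint from the
  negative part of \<open>d\<close>, so \<open>d * x\<close> is nonnegative and strict positivity of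
  \<open>T\<close> makes it vanish. Testing on \<open>[0, e]\<close> alone is what the minorants
  below provide.\<close>

lemma le_if_T_mult_le:
  assumes "f \<in> L" "g \<in> L"
    and le: "\<And>x. x \<in> E \<Longrightarrow> 0 \<le> x \<Longrightarrow> x \<le> e \<Longrightarrow> T (f * x) \<le> T (g * x)"
  shows "f \<le> g"
proof -
  define d x where "d = f - g" and "x = inf (pprt d) e"
  have d: "d \<in> L"
    using assms by (simp add: d_def L_diff)
  have x: "x \<in> E" "0 \<le> x" "x \<le> e"
    using L_E[OF L_pprt[OF d]] by (auto simp: x_def)
  have "inf x (pprt (- d)) = 0"
    using inf_zero_mono[OF inf_pprt_pprt_minus[of d], of x "pprt (- d)"] x by (simp add: x_def)
  then have "pprt (- d) * x = 0"
    by (simp add: mult_eq_zero_if_inf_zero inf_commute)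
  then have dx: "d * x = pprt d * x"
    using pprt_diff_pprt_minus[of d] by (metis diff_zero left_diff_distrib)
  have "T (d * x) \<le> 0"
    using le[OF x] assms(1,2) x(1) by (simp add: d_def left_diff_distrib T_diff L_mult_E)
  then have "d * x = 0"
    using T_eq_0[of "d * x"] L_mult_E[OF d x(1)] x(2) by (simp add: dx mult_nonneg_nonneg)
  then have "inf (pprt d) e * pprt d = 0"
    by (simp add: dx mult_commute[of _ "pprt d"] flip: x_def)
  then have "pprt d = 0"
    by (rule inf_e_mult_eq_zero[OF zero_le_pprt])
  then show ?thesis
    using pprt_ge_self[of d] by (simp add: d_def)
qed

text \<open>The differences \<open>s - n\<close> decrease to 0, so order continuity applies; both
  Zorn arguments pass to suprema this way.\<close>

lemma chain_limit:
  assumes C: "C \<subseteq> E" "C \<noteq> {}" "\<And>x y. x \<in> C \<Longrightarrow> y \<in> C \<Longrightarrow> x \<le> y \<or> y \<le> x"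
    and s: "isLub E C s" and w: "w \<in> E" "\<And>n. n \<in> C \<Longrightarrow> w \<le> T (s - n)"
  shows "w \<le> 0"
proof (rule order_continuity[of "(\<lambda>n. s - n) ` C"])
  have s': "s \<in> E" "\<And>n. n \<in> C \<Longrightarrow> n \<le> s" "\<And>u. u \<in> E \<Longrightarrow> (\<And>n. n \<in> C \<Longrightarrow> n \<le> u) \<Longrightarrow> s \<le> u"
    using s by (auto simp: isLub_iff)
  show "(\<lambda>n. s - n) ` C \<subseteq> E"
    using s' C(1) by auto
  show "\<exists>z\<in>(\<lambda>n. s - n) ` C. z \<le> x \<and> z \<le> y"
    if xy: "x \<in> (\<lambda>n. s - n) ` C" "y \<in> (\<lambda>n. s - n) ` C" for x y
  proof -
    obtain m n where mn: "m \<in> C" "n \<in> C" "x = s - m" "y = s - n"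
      using xy by blast
    then have "m \<le> n \<or> n \<le> m"
      using C(3) by blast
    then show ?thesis
      using mn by (auto intro!: diff_left_mono)
  qed
  show "v \<le> 0" if "v \<in> E" and le: "\<And>d. d \<in> (\<lambda>n. s - n) ` C \<Longrightarrow> v \<le> d" for v
  proof -
    have "n \<le> s - v" if "n \<in> C" for n
      using le[OF imageI[OF that]] by (simp add: le_diff_eq add.commute)
    then have "s \<le> s - v"
      using s'(1) that(1) by (intro s'(3)) auto
    then show ?thesis
      by (simp add: le_diff_eq)
  qed
qed (use C w s in \<open>auto simp: isLub_iff\<close>)

text \<open>
  The factor \<open>G\<close> may be unbounded; it is split as \<open>G = (G \<sqinter> k e) + (G - G \<sqinter> k e)\<close>, the second part
  being at most \<open>G\<^sup>2 / k\<close>.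
\<close>

lemma mult_T_limit:
  assumes lim: "\<And>v. v \<in> E \<Longrightarrow> (\<And>d. d \<in> D \<Longrightarrow> v \<le> T d) \<Longrightarrow> v \<le> 0"
    and D: "\<And>d. d \<in> D \<Longrightarrow> d \<in> E" "\<And>d. d \<in> D \<Longrightarrow> 0 \<le> d" "\<And>d. d \<in> D \<Longrightarrow> T d \<le> b"
    and G: "G \<in> R" "0 \<le> G" and b: "b \<in> R"
    and w: "w \<in> E" "\<And>d. d \<in> D \<Longrightarrow> w \<le> G * T d"
  shows "w \<le> 0"
proof (rule archimedean_inverse)
  fix k
  define B where "B = (1 / real (Suc k)) *\<^sub>R (G * G * b)"
  define c where "c = inf G (real (Suc k) *\<^sub>R e)"
  have "G * G * b \<in> R"
    using G(1) b by (intro R_mult_R)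
  then have "B \<in> E"
    using R_subset_E by (simp add: B_def)
  \<comment> \<open>For fixed \<open>k\<close> the bounded factor contributes at most a constant
    times \<open>T d\<close>, which \<open>lim\<close> removes; the unbounded part leaves
    \<open>B\<close>, which vanishes as \<open>k\<close> grows.\<close>
  have "(1 / real (Suc k)) *\<^sub>R (w - B) \<le> 0"
  proof (rule lim)
    show "(1 / real (Suc k)) *\<^sub>R (w - B) \<in> E"
      using w(1) \<open>B \<in> E\<close> by blast
    fix d assume d: "d \<in> D"
    have Td: "0 \<le> T d"
      using T_nonneg D(1,2) d by blast
    have "w \<le> c * T d + (G - c) * T d"
      using w(2)[OF d] by (simp flip: distrib_right)
    also have "c * T d \<le> (real (Suc k) *\<^sub>R e) * T d"
      using Td by (intro mult_right_mono) (auto simp: c_def)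
    also have "(G - c) * T d \<le> ((1 / real (Suc k)) *\<^sub>R (G * G)) * T d"
      using truncation_error[OF G(2), of k] Td unfolding c_def by (rule mult_right_mono)
    also have "\<dots> \<le> ((1 / real (Suc k)) *\<^sub>R (G * G)) * b"
      using D(3)[OF d] G(2) by (intro mult_left_mono scaleR_nonneg) (auto intro: mult_nonneg_nonneg)
    finally have "w - B \<le> real (Suc k) *\<^sub>R T d"
      by (simp add: B_def diff_le_eq)
    then have "(1 / real (Suc k)) *\<^sub>R (w - B) \<le> (1 / real (Suc k)) *\<^sub>R (real (Suc k) *\<^sub>R T d)"
      by (rule scaleR_left_mono) simp
    then show "(1 / real (Suc k)) *\<^sub>R (w - B) \<le> T d"
      by simp
  qed
  then have "real (Suc k) *\<^sub>R ((1 / real (Suc k)) *\<^sub>R (w - B)) \<le> real (Suc k) *\<^sub>R 0"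
    by (rule scaleR_left_mono) simp
  then show "w \<le> (1 / real (Suc k)) *\<^sub>R (G * G * b)"
    by (simp add: B_def)
qed


section \<open>The Radon-Nikodym theorem\<close>

context
  fixes \<psi> :: "'a \<Rightarrow> 'a" and G :: 'a
  assumes \<psi>_R: "\<And>x. x \<in> E \<Longrightarrow> \<psi> x \<in> R"
    and \<psi>_add: "\<And>x y. x \<in> E \<Longrightarrow> y \<in> E \<Longrightarrow> \<psi> (x + y) = \<psi> x + \<psi> y"
    and \<psi>_mult: "\<And>r x. r \<in> R \<Longrightarrow> x \<in> E \<Longrightarrow> \<psi> (r * x) = r * \<psi> x"
    and \<psi>_nonneg: "\<And>x. x \<in> E \<Longrightarrow> 0 \<le> x \<Longrightarrow> 0 \<le> \<psi> x"
    and \<psi>_le: "\<And>x. x \<in> E \<Longrightarrow> 0 \<le> x \<Longrightarrow> \<psi> x \<le> G * T x"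
    and G: "G \<in> R" "0 \<le> G"
begin

lemma \<psi>_diff: "x \<in> E \<Longrightarrow> y \<in> E \<Longrightarrow> \<psi> (x - y) = \<psi> x - \<psi> y"
  using \<psi>_add[of "x - y" y] by (simp add: eq_diff_eq)

lemma \<psi>_scaleR: "x \<in> E \<Longrightarrow> \<psi> (c *\<^sub>R x) = c *\<^sub>R \<psi> x"
  using \<psi>_mult[OF R_closed(5)[OF e_in_R], of x c] by simp

text \<open>The bound \<open>h \<le> G\<close> keeps minorants in \<open>L\<close> and bounds their
  chains. Testing on \<open>x \<le> e\<close> gives \<open>T ((s - n) * x) \<le> T (s - n)\<close>,
  a bound uniform in \<open>x\<close> that carries the condition to suprema.\<close>

definition minorants :: "'a set" where
  "minorants = {h\<in>E. 0 \<le> h \<and> h \<le> G \<and> (\<forall>x\<in>E. 0 \<le> x \<longrightarrow> x \<le> e \<longrightarrow> T (h * x) \<le> \<psi> x)}"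

lemma minorant_L: "h \<in> minorants \<Longrightarrow> h \<in> L"
  using L_I[OF G(1)] by (simp add: minorants_def)

lemma minorant_in_E: "h \<in> minorants \<Longrightarrow> x \<in> E \<Longrightarrow> h * x \<in> E"
  using L_mult_E minorant_L by blast

lemma exists_maximal_minorant:
  "\<exists>h\<in>minorants. \<forall>k\<in>minorants. h \<le> k \<longrightarrow> k = h"
proof (rule exists_maximal)
  have "0 \<in> minorants"
    using G \<psi>_nonneg by (simp add: minorants_def)
  then show "minorants \<noteq> {}"
    by blast
next
  fix C assume C: "C \<subseteq> minorants" "C \<noteq> {}" "\<And>x y. x \<in> C \<Longrightarrow> y \<in> C \<Longrightarrow> x \<le> y \<or> y \<le> x"
  have CE: "C \<subseteq> E" and bounds: "\<And>n. n \<in> C \<Longrightarrow> 0 \<le> n" "\<And>n. n \<in> C \<Longrightarrow> n \<le> G"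
    using C(1) by (auto simp: minorants_def)
  obtain s where s: "isLub E C s"
    using dedekind_completeE[OF dedekind_E CE C(2) R_subset_E[OF G(1)]] bounds(2) by metis
  then have s': "s \<in> E" "\<And>n. n \<in> C \<Longrightarrow> n \<le> s" "s \<le> G"
    using R_subset_E[OF G(1)] bounds(2) by (simp_all add: isLub_iff)
  have "0 \<le> s"
    using C(2) s'(2) bounds(1) order_trans by blast
  then have "s \<in> L"
    using s'(3) by (intro L_I[OF G(1)]) simp
  have "T (s * x) \<le> \<psi> x" if x: "x \<in> E" "0 \<le> x" "x \<le> e" for x
  proof -
    have sx: "s * x \<in> E"
      using L_mult_E \<open>s \<in> L\<close> x(1) by blast
    have "T (s * x) - \<psi> x \<le> 0"
    proof (rule chain_limit[OF CE C(2,3) s])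
      show "T (s * x) - \<psi> x \<in> E"
        using sx \<psi>_R[OF x(1)] R_subset_E by blast
      fix n assume n: "n \<in> C"
      then have nm: "n \<in> minorants"
        using C(1) by blast
      then have "T (n * x) \<le> \<psi> x"
        using x by (simp add: minorants_def)
      then have "T (s * x) - \<psi> x \<le> T (s * x) - T (n * x)"
        by (rule diff_left_mono)
      also have "\<dots> = T ((s - n) * x)"
        using sx minorant_in_E[OF nm x(1)] by (simp add: left_diff_distrib T_diff)
      also have "\<dots> \<le> T (s - n)"
        using sx minorant_in_E[OF nm x(1)] s' n CE x mult_le_self[of x "s - n"]
        by (intro T_mono) (auto simp: left_diff_distrib)
      finally show "T (s * x) - \<psi> x \<le> T (s - n)" .
    qed
    then show ?thesis
      by simp
  qed
  then have "s \<in> minorants"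
    using s'(1,3) \<open>0 \<le> s\<close> by (simp add: minorants_def)
  then show "\<exists>u\<in>minorants. \<forall>a\<in>C. a \<le> u"
    using s'(2) by blast
qed

text \<open>
  A Hahn-type argument without components of \<open>e\<close>: an element \<open>N\<close> of \<open>[0, e]\<close> that is maximal subject
  to \<open>\<psi> N - T (h * N) \<le> \<epsilon> * T N\<close> leaves a complement \<open>e - N\<close> below which the reverse inequality
  holds, so that \<open>h + \<epsilon> * (e - N)\<close> is a minorant and maximality of \<open>h\<close> gives \<open>N = e\<close>.
\<close>

lemma maximal_minorant_remainder:
  assumes h: "h \<in> minorants" "\<And>k. k \<in> minorants \<Longrightarrow> h \<le> k \<Longrightarrow> k = h" and "0 < \<epsilon>"
  shows "\<psi> e - T h \<le> \<epsilon> *\<^sub>R e"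
proof -
  define \<rho> where "\<rho> x = \<psi> x - T (h * x)" for x
  \<comment> \<open>The signed functional to be decomposed; it is \<open>R(T)\<close>-linear with
    values in \<open>R(T)\<close>.\<close>
  define \<sigma> where "\<sigma> x = \<rho> x - \<epsilon> *\<^sub>R T x" for x
  note hx = minorant_in_E[OF h(1)]
  have h': "h \<in> E" "0 \<le> h" "h \<le> G" "h \<in> L"
    and hle: "\<And>x. x \<in> E \<Longrightarrow> 0 \<le> x \<Longrightarrow> x \<le> e \<Longrightarrow> T (h * x) \<le> \<psi> x"
    using h(1) minorant_L by (auto simp: minorants_def)
  have \<sigma>_R: "\<sigma> x \<in> R" if "x \<in> E" for x
    using that hx \<psi>_R by (auto simp: \<sigma>_def \<rho>_def intro!: R_closed)
  have \<sigma>_diff: "\<sigma> (x - y) = \<sigma> x - \<sigma> y" if "x \<in> E" "y \<in> E" for x y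
    using that hx by (simp add: \<sigma>_def \<rho>_def \<psi>_diff T_diff algebra_simps)
  have \<sigma>_add: "\<sigma> (x + y) = \<sigma> x + \<sigma> y" if "x \<in> E" "y \<in> E" for x y
    using \<sigma>_diff[of "x + y" y] that by (simp add: eq_diff_eq)
  have \<sigma>_mult: "\<sigma> (r * x) = r * \<sigma> x" if "r \<in> R" "x \<in> E" for r x
    using that hx R_mult[OF that(1)] mult_left_commute[of h r]
    by (simp add: \<sigma>_def \<rho>_def \<psi>_mult algebra_simps)
  \<comment> \<open>This lets the condition \<open>\<sigma> n \<le> 0\<close> pass to the supremum
    \<open>s\<close> of a chain:
    \<open>\<sigma> s \<le> \<sigma> (s - n) \<le> G * T (s - n)\<close>.\<close>
  have \<sigma>_le: "\<sigma> x \<le> G * T x" if "x \<in> E" "0 \<le> x" for x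
  proof -
    have "0 \<le> T (h * x)" "0 \<le> \<epsilon> *\<^sub>R T x"
      using that hx h'(2) \<open>0 < \<epsilon>\<close> by (auto intro!: T_nonneg scaleR_nonneg mult_nonneg_nonneg)
    then have "\<sigma> x \<le> \<psi> x"
      by (simp add: \<sigma>_def \<rho>_def diff_le_eq add_increasing2 add_nonneg_nonneg)
    then show ?thesis
      using \<psi>_le[OF that] by (rule order_trans)
  qed
  define A where "A = {n\<in>E. 0 \<le> n \<and> n \<le> e \<and> \<sigma> n \<le> 0}"
  have "\<exists>N\<in>A. \<forall>n\<in>A. N \<le> n \<longrightarrow> n = N"
  proof (rule exists_maximal)
    have "\<sigma> 0 = 0"
      using \<sigma>_diff[of 0 0] by simp
    then show "A \<noteq> {}"
      by (auto simp: A_def intro!: exI[of _ 0])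
  next
    fix C assume C: "C \<subseteq> A" "C \<noteq> {}" "\<And>x y. x \<in> C \<Longrightarrow> y \<in> C \<Longrightarrow> x \<le> y \<or> y \<le> x"
    have CE: "C \<subseteq> E" and bounds: "\<And>n. n \<in> C \<Longrightarrow> 0 \<le> n" "\<And>n. n \<in> C \<Longrightarrow> n \<le> e"
      using C(1) by (auto simp: A_def)
    obtain s where s: "isLub E C s"
      using dedekind_completeE[OF dedekind_E CE C(2) e_in_E] bounds(2) by metis
    then have s': "s \<in> E" "\<And>n. n \<in> C \<Longrightarrow> n \<le> s" "s \<le> e"
      using bounds(2) by (simp_all add: isLub_iff)
    have "0 \<le> s"
      using C(2) s'(2) bounds(1) order_trans by blast
    have "\<sigma> s \<le> 0"
    proof (rule mult_T_limit[of "(\<lambda>n. s - n) ` C" e G])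
      show "v \<le> 0" if "v \<in> E" "\<And>d. d \<in> (\<lambda>n. s - n) ` C \<Longrightarrow> v \<le> T d" for v
        using chain_limit[OF CE C(2,3) s that(1)] that(2) by blast
      fix d assume "d \<in> (\<lambda>n. s - n) ` C"
      then obtain n where n: "n \<in> C" "d = s - n"
        by blast
      show d: "d \<in> E" "0 \<le> d"
        using n s' CE by auto
      have "d \<le> e"
        using s'(3) bounds(1)[OF n(1)] by (simp add: n(2) diff_le_eq add_increasing2)
      then show "T d \<le> e"
        using T_mono[OF d(1) e_in_E] by simp
      have "n \<in> E" "\<sigma> n \<le> 0"
        using n(1) C(1) by (auto simp: A_def)
      then have "\<sigma> s \<le> \<sigma> d"
        using \<sigma>_diff[OF s'(1)] by (simp add: n(2))
      then show "\<sigma> s \<le> G * T d"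
        using \<sigma>_le[OF d] by (rule order_trans)
    qed (use G s'(1) R_subset_E[OF \<sigma>_R] in auto)
    then show "\<exists>u\<in>A. \<forall>a\<in>C. a \<le> u"
      using s' \<open>0 \<le> s\<close> by (intro bexI[of _ s]) (auto simp: A_def)
  qed
  then obtain N where N: "N \<in> A" "\<And>n. n \<in> A \<Longrightarrow> N \<le> n \<Longrightarrow> n = N"
    by blast
  have N': "N \<in> E" "0 \<le> N" "N \<le> e" "\<sigma> N \<le> 0"
    using N(1) by (auto simp: A_def)
  define q where "q = e - N"
  have q: "q \<in> E" "0 \<le> q" "q \<le> e"
    using N' by (auto simp: q_def)
  have \<sigma>_nonneg: "0 \<le> \<sigma> p" if p: "p \<in> E" "0 \<le> p" "p \<le> q" for p
  proof -
    \<comment> \<open>\<open>u\<close> is the negative part of \<open>\<sigma> p\<close>, and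
      \<open>d\<close> in \<open>R(T)\<close> localises to where it lives:
      \<open>\<sigma> (d * p) = - (d * u)\<close>. Adding \<open>d * p\<close> to \<open>N\<close>
      stays in \<open>A\<close>, so maximality forces \<open>d * p = 0\<close>, then
      \<open>d * u = 0\<close> and \<open>u = 0\<close>.\<close>
    define u d where "u = pprt (- \<sigma> p)" and "d = inf u e"
    have "u \<in> R"
      using \<sigma>_R[OF p(1)] by (simp add: u_def R_closed)
    then have d: "d \<in> R" "0 \<le> d" "d \<le> e"
      by (auto simp: d_def u_def intro: R_closed)
    have "inf d (pprt (\<sigma> p)) = 0"
      using inf_zero_mono[of u "pprt (\<sigma> p)" d "pprt (\<sigma> p)"] inf_pprt_pprt_minus[of "\<sigma> p"] d(2)
      by (simp add: u_def d_def inf_commute)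
    then have "d * (pprt (\<sigma> p) - u) = - (d * u)"
      by (simp add: right_diff_distrib mult_eq_zero_if_inf_zero)
    then have \<sigma>dp: "\<sigma> (d * p) = - (d * u)"
      using \<sigma>_mult[OF d(1) p(1)] by (simp add: u_def pprt_diff_pprt_minus)
    have dp: "d * p \<in> E" "0 \<le> d * p"
      using R_mult(1) d p by (auto intro: mult_nonneg_nonneg)
    have "d * p \<le> p"
      using mult_right_mono[OF d(3) p(2)] by simp
    also note p(3)
    finally have "N + d * p \<le> e"
      by (simp add: q_def algebra_simps)
    moreover have "\<sigma> (N + d * p) \<le> 0"
    proof -
      have "0 \<le> d * u"
        using d(2) by (intro mult_nonneg_nonneg) (auto simp: u_def)
      then show ?thesis
        using \<sigma>_add[OF N'(1) dp(1)] add_nonpos_nonpos[OF N'(4), of "- (d * u)"] by (simp add: \<sigma>dp)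
    qed
    ultimately have "N + d * p \<in> A"
      using N' dp by (simp add: A_def)
    then have "d * p = 0"
      using N(2) dp(2) by fastforce
    then have "d * u = 0"
      using \<sigma>dp \<sigma>_diff[of 0 0] by simp
    then have "u = 0"
      using inf_e_mult_eq_zero[of u] by (simp add: d_def u_def)
    then show ?thesis
      using pprt_ge_self[of "- \<sigma> p"] by (simp add: u_def)
  qed
  have minorant: "T ((h + \<epsilon> *\<^sub>R q) * x) \<le> \<psi> x" if x: "x \<in> E" "0 \<le> x" "x \<le> e" for x
  proof -
    have qx: "q * x \<in> E" "0 \<le> q * x" "q * x \<le> q" "q * x \<le> x"
      using mult_unit_interval_in_E q x mult_le_self[OF x(2,3) q(2)] mult_right_mono[OF q(3) x(2)]
      by (auto intro: mult_nonneg_nonneg)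
    \<comment> \<open>On \<open>y\<close> the old minorant \<open>h\<close> is used; the increment
      is charged to \<open>q * x\<close>, which lies below \<open>q\<close>, where
      \<open>\<sigma>\<close> is nonnegative.\<close>
    define y where "y = x - q * x"
    have y: "y \<in> E" "0 \<le> y" "y \<le> e"
      using qx x by (auto simp: y_def intro: order_trans[OF _ x(3)])
    have "T (h * y) \<le> \<psi> y"
      using hle[OF y] .
    moreover have "T (h * (q * x)) + \<epsilon> *\<^sub>R T (q * x) \<le> \<psi> (q * x)"
      using \<sigma>_nonneg[OF qx(1-3)] by (simp add: \<sigma>_def \<rho>_def le_diff_eq add.commute)
    ultimately have "T (h * y) + (T (h * (q * x)) + \<epsilon> *\<^sub>R T (q * x)) \<le> \<psi> y + \<psi> (q * x)"
      by (rule add_mono)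
    also have "\<dots> = \<psi> x"
      using \<psi>_add[OF y(1) qx(1)] by (simp add: y_def)
    also have "T (h * y) + (T (h * (q * x)) + \<epsilon> *\<^sub>R T (q * x)) = T ((h + \<epsilon> *\<^sub>R q) * x)"
    proof -
      have "(h + \<epsilon> *\<^sub>R q) * x = h * y + (h * (q * x) + \<epsilon> *\<^sub>R (q * x))"
        by (simp add: y_def algebra_simps)
      then show ?thesis
        using hx y(1) qx(1) by (simp add: T_add T_scaleR)
    qed
    finally show ?thesis .
  qed
  have "q \<in> L"
    using L_I[OF e_in_R, of q] q by simp
  \<comment> \<open>The upper bound survives the increment because the test inequalities
    \<open>T ((h + \<epsilon> q) * x) \<le> \<psi> x \<le> T (G * x)\<close> determine the
    order.\<close>
  have "h + \<epsilon> *\<^sub>R q \<le> G"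
  proof (rule le_if_T_mult_le)
    show "h + \<epsilon> *\<^sub>R q \<in> L" "G \<in> L"
      using \<open>q \<in> L\<close> h'(4) R_L[OF G(1)] by (auto intro: L_add L_scaleR)
    fix x assume x: "x \<in> E" "0 \<le> x" "x \<le> e"
    show "T ((h + \<epsilon> *\<^sub>R q) * x) \<le> T (G * x)"
      using order_trans[OF minorant[OF x] \<psi>_le[OF x(1,2)]] R_mult(2)[OF G(1) x(1)] by simp
  qed
  moreover have "h \<le> h + \<epsilon> *\<^sub>R q" "0 \<le> h + \<epsilon> *\<^sub>R q" "h + \<epsilon> *\<^sub>R q \<in> E"
    using h' q \<open>0 < \<epsilon>\<close> by (auto intro!: scaleR_nonneg add_nonneg_nonneg)
  ultimately have "h + \<epsilon> *\<^sub>R q = h"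
    using minorant by (intro h(2)) (auto simp: minorants_def)
  then have "N = e"
    using \<open>0 < \<epsilon>\<close> by (simp add: q_def)
  then show ?thesis
    using N'(4) by (simp add: \<sigma>_def \<rho>_def)
qed

text \<open>The defect \<open>\<rho>\<close> is nonnegative on \<open>[0, e]\<close> and nonpositive
  at \<open>e\<close>, so it vanishes on \<open>[0, e]\<close>, hence on bounded nonnegative
  elements. Order continuity of \<open>\<psi>\<close> is not assumed; domination by
  \<open>G * T\<close> supplies the limit for unbounded \<open>x\<close>.\<close>

theorem radon_nikodym:
  obtains h where "h \<in> L" "\<And>x. x \<in> E \<Longrightarrow> \<psi> x = T (h * x)"
proof -
  obtain h where h: "h \<in> minorants" "\<And>k. k \<in> minorants \<Longrightarrow> h \<le> k \<Longrightarrow> k = h"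
    using exists_maximal_minorant by blast
  define \<rho> where "\<rho> x = \<psi> x - T (h * x)" for x
  note hx = minorant_in_E[OF h(1)]
  have h': "h \<in> E" "0 \<le> h" "h \<le> G" "h \<in> L"
    and hle: "\<And>x. x \<in> E \<Longrightarrow> 0 \<le> x \<Longrightarrow> x \<le> e \<Longrightarrow> T (h * x) \<le> \<psi> x"
    using h(1) minorant_L by (auto simp: minorants_def)
  have \<rho>_E: "\<rho> x \<in> E" if "x \<in> E" for x
    using R_subset_E[OF \<psi>_R[OF that]] hx[OF that] by (auto simp: \<rho>_def)
  have \<rho>_diff: "\<rho> (x - y) = \<rho> x - \<rho> y" if "x \<in> E" "y \<in> E" for x y
    using that hx by (simp add: \<rho>_def \<psi>_diff T_diff algebra_simps)
  have \<rho>_scaleR: "\<rho> (c *\<^sub>R x) = c *\<^sub>R \<rho> x" if "x \<in> E" for c x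
    using that hx by (simp add: \<rho>_def \<psi>_scaleR T_scaleR algebra_simps)
  have "\<rho> e \<le> 0"
    using maximal_minorant_remainder[OF h] by (intro archimedean_pos[of "\<rho> e" e]) (simp add: \<rho>_def)
  have unit: "\<rho> x = 0" if x: "x \<in> E" "0 \<le> x" "x \<le> e" for x
  proof (rule order_antisym)
    have "0 \<le> \<rho> (e - x)"
      using hle[of "e - x"] x by (simp add: \<rho>_def)
    then show "\<rho> x \<le> 0"
      using \<open>\<rho> e \<le> 0\<close> x(1) by (simp add: \<rho>_diff order_trans)
    show "0 \<le> \<rho> x"
      using hle[OF x] by (simp add: \<rho>_def)
  qed
  have nonneg: "\<rho> x = 0" if x: "x \<in> E" "0 \<le> x" for x
  proof -
    \<comment> \<open>Since \<open>\<rho>\<close> vanishes on every truncation,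
      \<open>\<rho> x\<close> equals \<open>\<rho> d\<close> for each truncation error
      \<open>d\<close>, and is thus bounded by \<open>G * T d\<close> on both sides.\<close>
    define D where "D = range (\<lambda>k. x - inf x (real (Suc k) *\<^sub>R e))"
    have D: "\<rho> x \<le> G * T d \<and> - \<rho> x \<le> G * T d" "d \<in> E" "0 \<le> d" "T d \<le> T x" if "d \<in> D" for d
    proof -
      obtain k where "d = x - inf x (real (Suc k) *\<^sub>R e)"
        using \<open>d \<in> D\<close> unfolding D_def by blast
      then obtain c where c: "c = inf x (real (Suc k) *\<^sub>R e)" and d: "d = x - c"
        by blast
      have c': "c \<in> E" "0 \<le> c" "c \<le> real (Suc k) *\<^sub>R e" "c \<le> x"
        using x unfolding c by (auto intro!: le_infI scaleR_nonneg)
      show d': "d \<in> E" "0 \<le> d"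
        using c' x by (auto simp: d)
      have "d \<le> x"
        using c'(2) by (simp add: d)
      then show "T d \<le> T x"
        using d'(1) x(1) by (rule T_mono[rotated 2])
      have "(1 / real (Suc k)) *\<^sub>R c \<le> (1 / real (Suc k)) *\<^sub>R (real (Suc k) *\<^sub>R e)"
        by (intro scaleR_left_mono c') simp
      then have "\<rho> ((1 / real (Suc k)) *\<^sub>R c) = 0"
        using c'(1,2) by (intro unit) (auto intro: scaleR_nonneg)
      then have "\<rho> c = 0"
        using c'(1) by (simp add: \<rho>_scaleR)
      then have \<rho>x: "\<rho> x = \<psi> d - T (h * d)"
        using \<rho>_diff[OF x(1) c'(1)] by (simp add: d \<rho>_def)
      have "h * d \<le> G * d"
        using h'(3) d'(2) by (rule mult_right_mono)
      then have "T (h * d) \<le> G * T d"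
        using T_mono[OF hx[OF d'(1)] R_mult(1)[OF G(1) d'(1)]] R_mult(2)[OF G(1) d'(1)] by simp
      moreover have "0 \<le> T (h * d)"
        using hx[OF d'(1)] h'(2) d'(2) by (intro T_nonneg mult_nonneg_nonneg)
      ultimately show "\<rho> x \<le> G * T d \<and> - \<rho> x \<le> G * T d"
        using \<psi>_nonneg[OF d'] \<psi>_le[OF d']
        by (simp add: \<rho>x diff_le_eq add_increasing2)
    qed
    have lim: "v \<le> 0" if "v \<in> E" "\<And>d. d \<in> D \<Longrightarrow> v \<le> T d" for v
      using that(2) by (intro T_truncation_limit[OF x that(1)]) (simp add: D_def del: diff_inf_eq_sup)
    have "T x \<in> R"
      using x(1) by blast
    have "\<rho> x \<le> 0"
      using D(1) \<rho>_E[OF x(1)] by (intro mult_T_limit[OF lim D(2-4) G \<open>T x \<in> R\<close>]) auto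
    moreover have "- \<rho> x \<le> 0"
      using D(1) \<rho>_E[OF x(1)] by (intro mult_T_limit[OF lim D(2-4) G \<open>T x \<in> R\<close>]) auto
    ultimately show ?thesis
      by simp
  qed
  have "\<rho> x = 0" if "x \<in> E" for x
    using \<rho>_diff[of "pprt x" "pprt (- x)"] nonneg[of "pprt x"] nonneg[of "pprt (- x)"] that
    by (simp add: pprt_diff_pprt_minus)
  then show thesis
    using that[OF h'(4)] by (simp add: \<rho>_def)
qed

end


section \<open>The representation map\<close>

lemma strong_dual_representation:
  assumes "\<phi> \<in> strong_dual E T"
  obtains f where "f \<in> L" "\<phi> = Phi E T f"
proof -
  have \<phi>_fun: "\<phi> \<in> E \<rightarrow>\<^sub>E R" and add: "\<And>x y. x \<in> E \<Longrightarrow> y \<in> E \<Longrightarrow> \<phi> (x + y) = \<phi> x + \<phi> y"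
    and mult: "\<And>r x. r \<in> R \<Longrightarrow> x \<in> E \<Longrightarrow> \<phi> (r * x) = r * \<phi> x"
    using assms by (auto simp: strong_dual_def module_linear_def regular_ops_def)
  obtain G where G: "G \<in> R" "0 \<le> G" "\<And>x. x \<in> E \<Longrightarrow> \<bar>\<phi> x\<bar> \<le> G * T \<bar>x\<bar>"
    using assms by (auto simp: strong_dual_def norm_1_bounded_def norm_1_def)
  have \<phi>_R: "\<phi> x \<in> R" if "x \<in> E" for x
    using \<phi>_fun that by (rule PiE_mem)
  \<comment> \<open>\<open>G\<close> is a constant from the norm bound of \<open>\<phi>\<close>, so
    \<open>\<psi>\<close> is positive and dominated by \<open>(G + G) * T x\<close>; subtracting
    \<open>G\<close> from the density of \<open>\<psi>\<close> recovers
    \<open>\<phi>\<close>.\<close>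
  define \<psi> where "\<psi> x = \<phi> x + G * T x" for x
  have bounds: "\<phi> x \<le> G * T x" "- \<phi> x \<le> G * T x" if "x \<in> E" "0 \<le> x" for x
    using G(3)[OF that(1)] that(2) by (auto simp: abs_le_iff)
  obtain h where h: "h \<in> L" "\<And>x. x \<in> E \<Longrightarrow> \<psi> x = T (h * x)"
  proof (rule radon_nikodym[of \<psi> "G + G"])
    show "\<psi> x \<in> R" if "x \<in> E" for x
      unfolding \<psi>_def using that by (intro R_closed(2) \<phi>_R R_mult_R G(1) imageI)
    show "\<psi> (x + y) = \<psi> x + \<psi> y" if "x \<in> E" "y \<in> E" for x y
      using that by (simp add: \<psi>_def add T_add distrib_left add_ac)
    show "\<psi> (r * x) = r * \<psi> x" if "r \<in> R" "x \<in> E" for r x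
      using that R_mult(2)[OF that] mult_left_commute[of G r]
      by (simp only: \<psi>_def mult distrib_left)
    show "0 \<le> \<psi> x" if "x \<in> E" "0 \<le> x" for x
    proof -
      have "0 \<le> G * T x - (- \<phi> x)"
        using bounds(2)[OF that] by (simp only: diff_ge_0_iff_ge)
      then show ?thesis
        by (simp add: \<psi>_def add.commute)
    qed
    show "\<psi> x \<le> (G + G) * T x" if "x \<in> E" "0 \<le> x" for x
      using bounds(1)[OF that] by (simp add: \<psi>_def distrib_right)
    show "G + G \<in> R" "0 \<le> G + G"
      using G(1,2) by (auto intro: R_closed add_nonneg_nonneg)
  qed blast
  have GL: "G \<in> L"
    by (rule R_L[OF G(1)])
  have "\<phi> x = T ((h - G) * x)" if x: "x \<in> E" for x
  proof -
    have "T ((h - G) * x) = T (h * x) - T (G * x)"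
      using L_mult_E[OF h(1) x] L_mult_E[OF GL x] by (simp add: left_diff_distrib T_diff)
    moreover have "\<phi> x = T (h * x) - G * T x"
      using h(2)[OF x] by (simp only: \<psi>_def eq_diff_eq)
    ultimately show ?thesis
      using R_mult(2)[OF G(1) x] by simp
  qed
  \<comment> \<open>Both functions are \<open>undefined\<close> outside \<open>E\<close>, so
    agreement on \<open>E\<close> is equality.\<close>
  then have "\<phi> = Phi E T (h - G)"
    using \<phi>_fun by (intro ext) (auto simp: Phi_def PiE_def extensional_def)
  with L_diff[OF h(1) GL] show thesis
    by (rule that)
qed

lemma T_mult_module_linear:
  assumes "f \<in> L"
  shows "module_linear R E (+) (*) (\<lambda>x. T (f * x))"
  using R_mult(2)[OF _ L_mult_E[OF assms]] L_mult_E[OF assms]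
  by (simp add: module_linear_def distrib_left T_add mult_left_commute[of f])

lemma T_mult_norm_1_bounded:
  assumes "f \<in> L"
  shows "norm_1_bounded E T (\<lambda>x. T (f * x))"
proof -
  obtain r where r: "r \<in> R" "\<bar>f\<bar> \<le> r"
    using L_bound[OF assms] .
  then have "0 \<le> r" "\<forall>x\<in>E. \<bar>T (f * x)\<bar> \<le> r * norm_1 T x"
    using order_trans[OF abs_ge_zero] T_mult_bound[OF r] by (auto simp: norm_1_def)
  then show ?thesis
    unfolding norm_1_bounded_def using r(1) by blast
qed

lemma T_mult_linear_op:
  assumes "f \<in> L"
  shows "linear_op E R (\<lambda>x. T (f * x))"
  using L_mult_E[OF assms] by (auto simp: linear_op_def distrib_left T_add T_scaleR)

lemma T_mult_positive_op:
  assumes "f \<in> L" "0 \<le> f"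
  shows "positive_op E (\<lambda>x. T (f * x))"
  using L_mult_E[OF assms(1)] assms(2)
  by (auto simp: positive_op_def intro!: T_nonneg mult_nonneg_nonneg)

lemma Phi_regular:
  assumes "f \<in> L"
  shows "Phi E T f \<in> regular_ops E R"
proof -
  have p: "pprt f \<in> L" and n: "pprt (- f) \<in> L"
    using assms by (auto intro: L_pprt L_minus)
  have "T (f * x) = T (pprt f * x) - T (pprt (- f) * x)" if "x \<in> E" for x
  proof -
    have "f * x = pprt f * x - pprt (- f) * x"
      by (simp only: left_diff_distrib[symmetric] pprt_diff_pprt_minus)
    then show ?thesis
      using L_mult_E[OF p that] L_mult_E[OF n that] by (simp add: T_diff)
  qed
  then have "\<forall>x\<in>E. Phi E T f x = T (pprt f * x) - T (pprt (- f) * x)"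
    by (simp add: Phi_def)
  moreover have "Phi E T f \<in> E \<rightarrow>\<^sub>E R"
    using L_mult_E[OF assms] by (auto simp: Phi_def)
  ultimately show ?thesis
    unfolding regular_ops_def
    using T_mult_linear_op[OF p] T_mult_linear_op[OF n] T_mult_positive_op[OF p] T_mult_positive_op[OF n]
      zero_le_pprt by blast
qed

lemma Phi_strong_dual:
  assumes "f \<in> L"
  shows "Phi E T f \<in> strong_dual E T"
proof -
  have "module_linear R E (+) (*) (Phi E T f)"
    using T_mult_module_linear[OF assms] R_mult(1) by (simp add: module_linear_def Phi_def)
  moreover have "norm_1_bounded E T (Phi E T f)"
    using T_mult_norm_1_bounded[OF assms] by (simp add: norm_1_bounded_def Phi_def)
  ultimately show ?thesis
    using Phi_regular[OF assms] by (simp add: strong_dual_def)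
qed

lemma Phi_bij: "bij_betw (Phi E T) L (strong_dual E T)"
proof (intro bij_betw_imageI inj_onI subset_antisym subsetI)
  fix f g assume fg: "f \<in> L" "g \<in> L" "Phi E T f = Phi E T g"
  have eq: "T (f * x) = T (g * x)" if "x \<in> E" for x
    using fun_cong[OF fg(3), of x] that by (simp add: Phi_def)
  show "f = g"
  proof (rule order_antisym)
    show "f \<le> g"
      by (rule le_if_T_mult_le[OF fg(1,2)]) (simp add: eq)
    show "g \<le> f"
      by (rule le_if_T_mult_le[OF fg(2,1)]) (simp add: eq)
  qed
next
  fix \<phi> assume "\<phi> \<in> strong_dual E T"
  then show "\<phi> \<in> Phi E T ` L"
    by (rule strong_dual_representation) blast
qed (use Phi_strong_dual in auto)

text \<open>For the component \<open>p\<close> carried by the positive part of \<open>f - g\<close>,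
  that positive part is \<open>(f - g) * p\<close>. So the supremum selects \<open>f\<close> on
  \<open>p\<close> and \<open>g\<close> on \<open>e - p\<close>, and the infimum the
  reverse.\<close>

lemma sup_inf_mult_split:
  assumes "f \<in> L" "g \<in> L"
  obtains p where "p \<in> E" "0 \<le> p" "p \<le> e"
    "\<And>x. sup f g * x = f * (p * x) + g * ((e - p) * x)"
    "\<And>x. inf f g * x = g * (p * x) + f * ((e - p) * x)"
proof -
  define d where "d = f - g"
  have "d \<in> E"
    using L_E[OF L_diff[OF assms]] by (simp add: d_def)
  obtain p where p: "p \<in> E" "0 \<le> p" "p \<le> e" "p * pprt d = pprt d"
    "\<And>w. w \<in> E \<Longrightarrow> inf (pprt d) w = 0 \<Longrightarrow> inf p w = 0"
    using component_exists[OF riesz_E dedekind_E e_in_E, of "pprt d"] \<open>d \<in> E\<close> by auto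
  have "p * pprt (- d) = 0"
    using p(5)[of "pprt (- d)"] \<open>d \<in> E\<close>
    by (simp add: inf_pprt_pprt_minus mult_eq_zero_if_inf_zero)
  then have "p * (pprt d - pprt (- d)) = pprt d"
    using p(4) by (simp only: right_diff_distrib) simp
  then have "p * d = pprt d"
    by (simp only: pprt_diff_pprt_minus)
  then have d: "pprt (f - g) = (f - g) * p"
    by (simp only: d_def mult_commute[of "f - g" p])
  have "sup f g * x = f * (p * x) + g * ((e - p) * x)" "inf f g * x = g * (p * x) + f * ((e - p) * x)"
    for x
    by (simp_all only: sup_eq_add_pprt inf_eq_diff_pprt d)
      (simp_all add: algebra_simps)
  with p(1-3) show thesis
    by (rule that)
qed

lemma regular_ops_add:
  "\<tau> \<in> regular_ops E R \<Longrightarrow> x \<in> E \<Longrightarrow> y \<in> E \<Longrightarrow> \<tau> (x + y) = \<tau> x + \<tau> y"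
  by (auto simp: regular_ops_def linear_op_def)

lemma op_le_Phi_iff: "op_le E (Phi E T f) \<tau> \<longleftrightarrow> (\<forall>x\<in>E. 0 \<le> x \<longrightarrow> T (f * x) \<le> \<tau> x)"
  by (simp add: op_le_def positive_op_def Phi_def)

lemma Phi_le_op_iff: "op_le E \<tau> (Phi E T f) \<longleftrightarrow> (\<forall>x\<in>E. 0 \<le> x \<longrightarrow> \<tau> x \<le> T (f * x))"
  by (simp add: op_le_def positive_op_def Phi_def)

lemma Phi_mono:
  assumes "f \<in> L" "g \<in> L" "f \<le> g"
  shows "op_le E (Phi E T f) (Phi E T g)"
  unfolding op_le_Phi_iff
  using assms L_mult_E by (auto simp: Phi_def intro!: T_mono mult_right_mono)

text \<open>The competing bound \<open>\<tau>\<close> is any regular operator, possibly outside the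
  strong dual. Its additivity suffices: it is compared with one of the two functionals on
  \<open>p * x\<close> and with the other on \<open>(e - p) * x\<close>.\<close>

lemma Phi_sup_inf:
  assumes "f \<in> L" "g \<in> L"
  shows "op_is_sup E R (Phi E T f) (Phi E T g) (Phi E T (sup f g))"
    and "op_is_inf E R (Phi E T f) (Phi E T g) (Phi E T (inf f g))"
proof -
  obtain p where p: "p \<in> E" "0 \<le> p" "p \<le> e"
    "\<And>x. sup f g * x = f * (p * x) + g * ((e - p) * x)"
    "\<And>x. inf f g * x = g * (p * x) + f * ((e - p) * x)"
    using sup_inf_mult_split[OF assms] by blast
  have parts: "p * x \<in> E" "0 \<le> p * x" "(e - p) * x \<in> E" "0 \<le> (e - p) * x" if "x \<in> E" "0 \<le> x" for x
    using that p mult_unit_interval_in_E[of p x] mult_unit_interval_in_E[of "e - p" x]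
    by (auto intro!: mult_nonneg_nonneg)
  have split: "\<tau> (p * x) + \<tau> ((e - p) * x) = \<tau> x" if "\<tau> \<in> regular_ops E R" "x \<in> E" "0 \<le> x" for \<tau> x
    using regular_ops_add[OF that(1) parts(1,3)[OF that(2,3)]] by (simp flip: distrib_right)
  have T_sup: "T (sup f g * x) = T (f * (p * x)) + T (g * ((e - p) * x))"
    and T_inf: "T (inf f g * x) = T (g * (p * x)) + T (f * ((e - p) * x))" if "x \<in> E" "0 \<le> x" for x
    using parts[OF that] L_mult_E assms by (simp_all add: p(4,5) T_add)
  have "op_le E (Phi E T (sup f g)) \<tau>"
    if \<tau>: "\<tau> \<in> regular_ops E R" "op_le E (Phi E T f) \<tau>" "op_le E (Phi E T g) \<tau>" for \<tau>
    unfolding op_le_Phi_iff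
  proof (intro ballI impI)
    fix x assume x: "x \<in> E" "0 \<le> x"
    show "T (sup f g * x) \<le> \<tau> x"
      unfolding T_sup[OF x] split[OF \<tau>(1) x, symmetric]
      using \<tau>(2,3) parts[OF x] by (intro add_mono) (auto simp: op_le_Phi_iff)
  qed
  then show "op_is_sup E R (Phi E T f) (Phi E T g) (Phi E T (sup f g))"
    using L_sup[OF assms] assms by (simp add: op_is_sup_def Phi_regular Phi_mono)
  have "op_le E \<tau> (Phi E T (inf f g))"
    if \<tau>: "\<tau> \<in> regular_ops E R" "op_le E \<tau> (Phi E T f)" "op_le E \<tau> (Phi E T g)" for \<tau>
    unfolding Phi_le_op_iff
  proof (intro ballI impI)
    fix x assume x: "x \<in> E" "0 \<le> x"
    show "\<tau> x \<le> T (inf f g * x)"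
      unfolding T_inf[OF x] split[OF \<tau>(1) x, symmetric]
      using \<tau>(2,3) parts[OF x] by (intro add_mono) (auto simp: Phi_le_op_iff)
  qed
  then show "op_is_inf E R (Phi E T f) (Phi E T g) (Phi E T (inf f g))"
    using L_inf[OF assms] assms by (simp add: op_is_inf_def Phi_regular Phi_mono)
qed

lemma Phi_riesz_isomorphism: "riesz_isomorphism_to_dual E T L (Phi E T)"
proof -
  have "Phi E T (f + g) = op_add E (Phi E T f) (Phi E T g)" if "f \<in> L" "g \<in> L" for f g
    using L_mult_E that by (auto simp: Phi_def op_add_def distrib_right T_add)
  moreover have "Phi E T (a *\<^sub>R f) = op_scaleR E a (Phi E T f)" if "f \<in> L" for a f
    using L_mult_E that by (auto simp: Phi_def op_scaleR_def T_scaleR)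
  ultimately show ?thesis
    by (simp add: riesz_isomorphism_to_dual_def Phi_bij Phi_sup_inf)
qed

lemma Phi_module_linear: "module_linear R L (op_add E) (op_mult E) (Phi E T)"
proof -
  have "Phi E T (f + g) = op_add E (Phi E T f) (Phi E T g)" if "f \<in> L" "g \<in> L" for f g
    using Phi_riesz_isomorphism that by (simp add: riesz_isomorphism_to_dual_def)
  moreover have "Phi E T (g * f) = op_mult E g (Phi E T f)" if "g \<in> R" "f \<in> L" for f g
    using R_mult(2)[OF that(1) L_mult_E[OF that(2)]]
    by (auto simp: Phi_def op_mult_def mult.assoc)
  ultimately show ?thesis
    by (simp add: module_linear_def)
qed

lemma Phi_isometric:
  assumes "f \<in> L"
  shows "dual_norm E T (Phi E T f) = norm_infty E T f"
proof -
  have "(\<forall>x\<in>E. \<bar>Phi E T f x\<bar> \<le> r * norm_1 T x) \<longleftrightarrow> \<bar>f\<bar> \<le> r" if r: "r \<in> R" for r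
  proof
    assume "\<bar>f\<bar> \<le> r"
    then show "\<forall>x\<in>E. \<bar>Phi E T f x\<bar> \<le> r * norm_1 T x"
      using T_mult_bound[OF r] by (simp add: Phi_def norm_1_def)
  next
    assume le: "\<forall>x\<in>E. \<bar>Phi E T f x\<bar> \<le> r * norm_1 T x"
    have *: "T (f * x) \<le> T (r * x)" "T (- f * x) \<le> T (r * x)" if x: "x \<in> E" "0 \<le> x" for x
      using le[rule_format, OF x(1)] x R_mult(2)[OF r x(1)] T_minus[OF L_mult_E[OF assms x(1)]]
      by (simp_all add: Phi_def norm_1_def abs_le_iff)
    have "f \<le> r"
      by (rule le_if_T_mult_le[OF assms R_L[OF r] *(1)])
    moreover have "- f \<le> r"
      by (rule le_if_T_mult_le[OF L_minus[OF assms] R_L[OF r] *(2)])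
    ultimately show "\<bar>f\<bar> \<le> r"
      by (rule abs_leI)
  qed
  then have "{r \<in> R. 0 \<le> r \<and> (\<forall>x\<in>E. \<bar>Phi E T f x\<bar> \<le> r * norm_1 T x)} = {r \<in> R. 0 \<le> r \<and> \<bar>f\<bar> \<le> r}"
    by blast
  then show ?thesis
    by (simp add: dual_norm_def norm_infty_def)
qed

end

theorem theorem6p7:
  fixes E :: "'a::f_algebra set" and e :: 'a and T :: "'a \<Rightarrow> 'a"
  assumes "universal_completion_of E"
    and "\<And>x::'a. e * x = x \<and> x * e = x"
    and "conditional_riesz_triple E e T"
    and "T_universally_complete E T"
  shows
    "(\<forall>f\<in>L_infty E T.
        (\<forall>g\<in>E. f * g \<in> E) \<and>
        (\<lambda>g. T (f * g)) \<in> E \<rightarrow> T ` E \<and>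
        module_linear (T ` E) E (+) (*) (\<lambda>g. T (f * g)) \<and>
        norm_1_bounded E T (\<lambda>g. T (f * g))) \<and>
     (riesz_isomorphism_to_dual E T (L_infty E T) (Phi E T) \<and>
      module_linear (T ` E) (L_infty E T) (op_add E) (op_mult E) (Phi E T) \<and>
      (\<forall>f\<in>L_infty E T. dual_norm E T (Phi E T f) = norm_infty E T f))"
proof -
  interpret T_universal_triple e E T
    using assms
    by unfold_locales (auto simp: universal_completion_of_def universally_complete_def
      conditional_riesz_triple_def weak_order_unit_def)
  show ?thesis
    using L_mult_E T_mult_module_linear T_mult_norm_1_bounded Phi_riesz_isomorphism
      Phi_module_linear Phi_isometric by blast
qed

end
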